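(* Let $\tau_L,\tau_R\in\mathbb{R}$, $\delta_L,\delta_R>0$, and let $f:\mathbb{R}^2\to\mathbb{R}^2$ be $$f(x)=\begin{cases}f_L(x)=\begin{bmatrix}\tau_L&1\\-\delta_L&0\end{bmatrix}x+\begin{bmatrix}1\\0\end{bmatrix},&x_1\le0,\\[2mm] f_R(x)=\begin{bmatrix}\tau_R&1\\-\delta_R&0\end{bmatrix}x+\begin{bmatrix}1\\0\end{bmatrix},&x_1\ge0.\end{cases}$$ Let $\beta>0$ and $X=(0,\beta)$, and suppose there exist $i,j\ge1$ such that $f^i(X)_1\le0$ and $f^{-j}(X)_1\ge0$. With $U,V,Y,Z,\ell,\Omega$ as defined in the context, suppose that $Y$ lies above $f^{-1}(U)$, that $Z$ lies above the line through $f^{-1}(U)$ and $V$, and that $Z$ lies to the right of the line through $V$ and $f(V)$. Let $$\Omega_{\rm rec}=\{x\in\Omega\mid x_1>0\},\qquad p_{\rm max}=\max[\chi_L(Y),\chi_L(Z)],\qquad \mathbf{W}=\{RL^p\mid 0\le p\le p_{\rm max}\}.$$ Then $\Omega_{\rm rec}$ is $\mathbf{W}$-recurrent and $\Omega\subset\bigcup_{i=-\ell}^{0}f^i(\Omega_{\rm rec})$.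
   Context: Since $\delta_L,\delta_R>0$, $f$ is a homeomorphism. Let $\Sigma=\{x\mid x_1=0\}$, so $f(\Sigma)=\{x\mid x_2=0\}$, and $\Pi_L=\{x\mid x_1\le0\}$. Let $r$ be the smallest $i\ge1$ with $f^i(X)_1\le0$ and $\ell$ the smallest $j\ge1$ with $f^{-j}(X)_1\ge0$ (one has $r,\ell\ge2$). $Z=f^r(X)$; $Y$ is the intersection of the line through $Z$ and $f^{-1}(Z)$ with $\Sigma$; $V=f^{-(\ell-1)}(X)$; $U$ is the intersection of the line through $V$ and $f(V)$ with $f(\Sigma)$. The closed polygonal chain formed by connecting, in order, $U,f^{-(\ell-2)}(X),\dots,f^{-1}(X),X,f(X),\dots,f^{r-1}(X),Z$, and then $Z$ back to $U$, is a Jordan curve; $\Omega$ denotes this chain together with its interior. "Above" and "to the right of" are strict, with $x_2$ vertical and $x_1$ horizontal. For $x\in\Pi_L$, $\chi_L(x)$ is the smallest $p\ge1$ with $f_L^p(x)\notin\Pi_L$ ($\infty$ if none). A word of length $n\ge1$ is a function $\mathcal{W}:\{0,\dots,n-1\}\to\{L,R\}$; $RL^p$ denotes $R$ followed by $p$ copies of $L$. Let $\gamma_{\rm set}(x)=\{L\}$ if $x_1<0$, $\{L,R\}$ if $x_1=0$, $\{R\}$ if $x_1>0$, and let $\Gamma(x;n)$ be the set of words $\mathcal{W}$ of length $n$ with $\mathcal{W}_i\in\gamma_{\rm set}(f^i(x))$ for $i=0,\dots,n-1$. A set $S\subset\mathbb{R}^2$ is $\mathbf{W}$-recurrent if for all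 $x\in S$ there exists $n\ge1$ such that $f^n(x)\in S$ and every $\mathcal{W}\in\Gamma(x;n)$ can be written as a concatenation of words in $\mathbf{W}$. *)

theory Defs
  imports "HOL-Analysis.Analysis" "HOL-Library.Extended_Nat"
begin

definition affine_piece :: "real \<Rightarrow> real \<Rightarrow> real^2 \<Rightarrow> real^2" where
  "affine_piece \<tau> \<delta> x =
     (vector [vector [\<tau>, 1], vector [- \<delta>, 0]] :: real^2^2) *v x + vector [1, 0]"

text \<open>The two pieces agree on the switching line, so giving it to the left piece is harmless.\<close>

definition bcnf :: "real \<Rightarrow> real \<Rightarrow> real \<Rightarrow> real \<Rightarrow> real^2 \<Rightarrow> real^2" where
  "bcnf \<tau>\<^sub>L \<delta>\<^sub>L \<tau>\<^sub>R \<delta>\<^sub>R x =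
     (if x $ 1 \<le> 0 then affine_piece \<tau>\<^sub>L \<delta>\<^sub>L x else affine_piece \<tau>\<^sub>R \<delta>\<^sub>R x)"

definition int_iter :: "('a \<Rightarrow> 'a) \<Rightarrow> int \<Rightarrow> 'a \<Rightarrow> 'a" where
  "int_iter f k = (if 0 \<le> k then f ^^ nat k else inv f ^^ nat (- k))"

definition Sigma_line :: "(real^2) set" where
  "Sigma_line = {x. x $ 1 = 0}"

definition Pi_L :: "(real^2) set" where
  "Pi_L = {x. x $ 1 \<le> 0}"

abbreviation line_through :: "real^2 \<Rightarrow> real^2 \<Rightarrow> (real^2) set" where
  "line_through a b \<equiv> affine hull {a, b}"

text \<open>The next two are meaningful for non-vertical and non-horizontal lines, respectively.\<close>

definition above_line :: "real^2 \<Rightarrow> (real^2) set \<Rightarrow> bool" where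
  "above_line p l \<longleftrightarrow> (\<exists>q\<in>l. q $ 1 = p $ 1 \<and> q $ 2 < p $ 2)"

definition right_of_line :: "real^2 \<Rightarrow> (real^2) set \<Rightarrow> bool" where
  "right_of_line p l \<longleftrightarrow> (\<exists>q\<in>l. q $ 2 = p $ 2 \<and> q $ 1 < p $ 1)"

fun polygonal_chain :: "(real^2) list \<Rightarrow> (real^2) set" where
  "polygonal_chain [] = {}"
| "polygonal_chain [p] = {p}"
| "polygonal_chain (p # q # ps) = closed_segment p q \<union> polygonal_chain (q # ps)"

text \<open>The infimum of the empty set is \<open>\<infinity>\<close>. The argument \<open>g\<close> is the left piece,
  iterated as an affine map of the whole plane.\<close>

definition chi_L :: "(real^2 \<Rightarrow> real^2) \<Rightarrow> real^2 \<Rightarrow> enat" where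
  "chi_L g x = Inf (enat ` {p. 1 \<le> p \<and> (g ^^ p) x \<notin> Pi_L})"

datatype symb = L | R

definition gamma_set :: "real^2 \<Rightarrow> symb set" where
  "gamma_set x = (if x $ 1 < 0 then {L} else if x $ 1 = 0 then {L, R} else {R})"

text \<open>Words are lists of symbols, the \<open>i\<close>-th symbol being \<open>w ! i\<close>.\<close>

definition Gamma_words :: "(real^2 \<Rightarrow> real^2) \<Rightarrow> real^2 \<Rightarrow> nat \<Rightarrow> symb list set" where
  "Gamma_words f x n = {w. length w = n \<and> (\<forall>i<n. w ! i \<in> gamma_set ((f ^^ i) x))}"

definition recurrent ::
    "(real^2 \<Rightarrow> real^2) \<Rightarrow> symb list set \<Rightarrow> (real^2) set \<Rightarrow> bool" where
  "recurrent f W S \<longleftrightarrow>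
     (\<forall>x\<in>S. \<exists>n\<ge>1. (f ^^ n) x \<in> S \<and>
        (\<forall>w\<in>Gamma_words f x n. \<exists>ws. set ws \<subseteq> W \<and> w = concat ws))"

end

theory Submission
  imports Defs
begin

text \<open>
  Let \<open>C\<close> be the closed chain. Writing \<open>\<Omega>\<close> as the complement of the outside of \<open>C\<close>, one never needs that
  \<open>C\<close> is a Jordan curve: as \<open>f\<close> is a homeomorphism, \<open>f(C) \<subseteq> \<Omega>\<close> implies \<open>f(\<Omega>) \<subseteq> \<Omega>\<close>, and a point is not in
  \<open>\<Omega>\<close> as soon as it lies on an unbounded connected set avoiding \<open>C\<close>.

  Unicoherence of the plane (Janiszewski), applied to the parts of \<open>\<Omega>\<close> above and below the horizontal
  axis, puts the segment from \<open>U\<close> to \<open>f(X)\<close>, hence \<open>f(Y)\<close>, in \<open>\<Omega>\<close>. The only parts of \<open>f(C)\<close> not on \<open>C\<close>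
  are the segments joining \<open>Z\<close>, \<open>f(Y)\<close>, \<open>f(Z)\<close>, \<open>f(U)\<close>; pulling an intersection with \<open>C\<close> back by \<open>f\<close>
  shows that they meet \<open>C\<close> only at \<open>Z\<close> and \<open>f(U)\<close>, so they lie in \<open>\<Omega>\<close> too.

  The first coordinate of \<open>f\<^sub>L\<^sup>k(x)\<close> is affine in \<open>x\<close>, with Lucas sequences as coefficients whose signs are
  determined by \<open>f\<^sup>-\<^sup>k(X)\<close> being on the left for \<open>k < \<ell>\<close>. A point of the left half-plane that
  stays there for \<open>\<ell>\<close> steps can be moved down to infinity without meeting \<open>C\<close>, so it is not in \<open>\<Omega>\<close>.
  If the image of a point of \<open>\<Omega>\<^sub>r\<^sub>e\<^sub>c\<close> stayed longer on the left than \<open>Y\<close> and \<open>Z\<close>, it could be moved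
  away from the origin to infinity without meeting \<open>f(C)\<close>, which is again impossible.
\<close>

lemma vec2_eqI: "x $ 1 = y $ 1 \<Longrightarrow> x $ 2 = y $ 2 \<Longrightarrow> x = y" for x y :: "real^2"
  by (simp add: vec_eq_iff forall_2)

subsection \<open>Filled compact sets\<close>

lemma connected_subset_inside:
  assumes "connected G" "G \<inter> C = {}" "x \<in> G" "x \<in> inside C"
  shows "G \<subseteq> inside C"
proof
  fix y assume "y \<in> G"
  then show "y \<in> inside C"
    using inside_outside_intersect_connected[OF assms(1), of C] assms
      inside_Un_outside[of C] by blast
qed

text \<open>The complement of the outside of a bounded set is bounded, so \<open>G\<close> meets the
  outside; being connected and disjoint from \<open>C\<close>, it cannot also meet the
  inside.\<close>

lemma unbounded_connected_subset_outside:
  fixes C :: "'a::euclidean_space set"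
  assumes "bounded C" "connected G" "G \<inter> C = {}" "\<not> bounded G"
  shows "G \<subseteq> outside C"
proof -
  have "\<not> G \<subseteq> - outside C"
    using cobounded_outside[OF \<open>bounded C\<close>] assms(4) bounded_subset by blast
  then obtain y where "y \<in> G" "y \<in> outside C" by blast
  then show ?thesis
    using inside_outside_intersect_connected[OF assms(2), of C] assms(3)
      inside_Un_outside[of C] by blast
qed

lemma not_bounded_ray:
  fixes x v :: "'a::real_normed_vector"
  assumes "v \<noteq> 0"
  shows "\<not> bounded ((\<lambda>t. x + t *\<^sub>R v) ` {a..})"
proof
  assume "bounded ((\<lambda>t. x + t *\<^sub>R v) ` {a..})"
  then obtain B where B: "\<And>t. t \<ge> a \<Longrightarrow> norm (x + t *\<^sub>R v) \<le> B"
    by (auto simp: bounded_iff)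
  define t where "t = max a ((\<bar>B\<bar> + norm x + 1) / norm v)"
  have "(\<bar>B\<bar> + norm x + 1) / norm v \<le> t" by (simp add: t_def)
  then have "\<bar>B\<bar> + norm x + 1 \<le> t * norm v"
    using assms by (simp add: field_simps)
  also have "\<dots> \<le> norm (t *\<^sub>R v)" by (simp add: mult_right_mono)
  also have "\<dots> \<le> norm (x + t *\<^sub>R v) + norm x"
    by (metis add.commute add_diff_cancel_left' norm_triangle_ineq4)
  also have "\<dots> \<le> B + norm x" using B[of t] by (simp add: t_def)
  finally show False by linarith
qed

lemma connected_ray:
  fixes x v :: "'a::real_normed_vector"
  shows "connected ((\<lambda>t. x + t *\<^sub>R v) ` {a..})"
  by (intro connected_continuous_image continuous_intros) (auto simp: is_interval_connected)

lemma ray_avoids_imp_outside: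
  fixes x v :: "'a::euclidean_space"
  assumes "bounded C" "v \<noteq> 0" "\<And>t. t \<ge> 0 \<Longrightarrow> x + t *\<^sub>R v \<notin> C"
  shows "x \<in> outside C"
proof -
  have "(\<lambda>t. x + t *\<^sub>R v) ` {0..} \<subseteq> outside C"
    using assms by (intro unbounded_connected_subset_outside not_bounded_ray connected_ray) auto
  moreover have "x \<in> (\<lambda>t. x + t *\<^sub>R v) ` {0..}" by (rule image_eqI[of _ _ 0]) auto
  ultimately show ?thesis by blast
qed

text \<open>In dimension at least two the outside of a compact set is connected. Its image is
  unbounded, since otherwise the image under \<open>h'\<close> of a compact closure would be a
  bounded set containing the outside.\<close>

lemma homeomorphism_image_outside:
  fixes C :: "'a::euclidean_space set" and h h' :: "'a \<Rightarrow> 'a"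
  assumes dim: "2 \<le> DIM('a)" and C: "compact C"
    and h: "continuous_on UNIV h" "continuous_on UNIV h'" "\<And>x. h (h' x) = x" "\<And>x. h' (h x) = x"
  shows "h ` outside C \<subseteq> outside (h ` C)"
proof (rule unbounded_connected_subset_outside)
  have bC: "bounded C" using C by (rule compact_imp_bounded)
  show "bounded (h ` C)"
    using C h(1) by (intro compact_imp_bounded compact_continuous_image continuous_on_subset[OF h(1)]) auto
  show "connected (h ` outside C)"
    using connected_outside[OF bC dim] by (intro connected_continuous_image continuous_on_subset[OF h(1)]) auto
  show "h ` outside C \<inter> h ` C = {}"
    using h(4) outside_no_overlap[of C] by (metis image_Int image_empty injI)
  show "\<not> bounded (h ` outside C)"
  proof
    assume "bounded (h ` outside C)"
    then have "compact (h' ` closure (h ` outside C))"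
      by (intro compact_continuous_image continuous_on_subset[OF h(2)]) (auto simp: compact_closure)
    moreover have "outside C \<subseteq> h' ` closure (h ` outside C)"
      using h(4) closure_subset[of "h ` outside C"] by (metis imageI subset_iff)
    ultimately have "bounded (outside C)" using compact_imp_bounded bounded_subset by blast
    then show False using unbounded_outside[OF bC] by simp
  qed
qed

text \<open>The argument is on complements: \<open>outside C\<close> is connected, unbounded and
  misses the image of \<open>C\<close>, hence lies outside that image. Applying \<open>h'\<close>
  shows that \<open>h'\<close> maps \<open>outside C\<close> into itself.\<close>

lemma homeomorphism_image_filled:
  fixes C :: "'a::euclidean_space set" and h h' :: "'a \<Rightarrow> 'a"
  assumes dim: "2 \<le> DIM('a)" and C: "compact C"
    and h: "continuous_on UNIV h" "continuous_on UNIV h'" "\<And>x. h (h' x) = x" "\<And>x. h' (h x) = x"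
    and sub: "h ` C \<subseteq> C \<union> inside C"
  shows "h ` (C \<union> inside C) \<subseteq> C \<union> inside C"
proof -
  have bC: "bounded C" using C by (rule compact_imp_bounded)
  have hC: "compact (h ` C)"
    using C by (intro compact_continuous_image continuous_on_subset[OF h(1)]) auto
  have "outside C \<subseteq> outside (h ` C)"
  proof (rule unbounded_connected_subset_outside)
    show "outside C \<inter> h ` C = {}" using sub union_with_inside by blast
  qed (use hC bC dim in \<open>auto simp: compact_imp_bounded connected_outside unbounded_outside\<close>)
  then have "h' ` outside C \<subseteq> h' ` outside (h ` C)" by blast
  also have "\<dots> \<subseteq> outside (h' ` h ` C)"
    by (rule homeomorphism_image_outside[OF dim hC h(2,1,4,3)])
  also have "h' ` h ` C = C" by (simp add: image_image h)
  finally show ?thesis unfolding union_with_inside using h(4) by (metis ComplD ComplI image_subset_iff)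
qed

text \<open>The ray in direction \<open>v\<close> from a point of the half-space stays in the
  half-space. From a point inside \<open>C\<close> it must hit \<open>C\<close>, which joins the
  point to the connected set \<open>C \<inter> ?H\<close> without leaving the filled set.\<close>

lemma connected_filled_Int_halfspace:
  fixes C :: "'a::euclidean_space set"
  assumes C: "compact C" and v: "v \<noteq> 0"
    and conn: "connected (C \<inter> {x. 0 \<le> v \<bullet> x})"
  shows "connected ((C \<union> inside C) \<inter> {x. 0 \<le> v \<bullet> x})"
proof -
  let ?H = "{x. 0 \<le> v \<bullet> x}"
  have bC: "bounded C" using C by (rule compact_imp_bounded)
  have ex: "\<exists>S. connected S \<and> x \<in> S \<and> S \<subseteq> (C \<union> inside C) \<inter> ?H \<and> S \<inter> C \<noteq> {}"
    if x: "x \<in> (C \<union> inside C) \<inter> ?H" for x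
  proof (cases "x \<in> C")
    case True
    then show ?thesis using x by (intro exI[of _ "{x}"]) auto
  next
    case False
    then have xi: "x \<in> inside C" using x by auto
    \<comment> \<open>\<open>Inf T\<close> is the first time at which the ray meets
      \<open>C\<close>; without such a time \<open>x\<close> would be outside. Before it, the ray
      stays inside \<open>C\<close>.\<close>
    define T where "T = {t. 0 \<le> t \<and> x + t *\<^sub>R v \<in> C}"
    have "x \<notin> outside C" using xi inside_Int_outside by blast
    then have "T \<noteq> {}" using ray_avoids_imp_outside[OF bC v, of x] by (auto simp: T_def)
    moreover have "closed T"
    proof -
      have "T = {0..} \<inter> (\<lambda>t. x + t *\<^sub>R v) -` C" by (auto simp: T_def)
      moreover have "closed ({0..} \<inter> (\<lambda>t. x + t *\<^sub>R v) -` C)"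
        using compact_imp_closed[OF C]
        by (intro closed_Int closed_atLeast closed_vimage continuous_intros)
      ultimately show ?thesis by simp
    qed
    moreover have bd: "bdd_below T" by (rule bdd_belowI[of _ 0]) (auto simp: T_def)
    ultimately have t0: "Inf T \<in> T" using closed_contains_Inf[of T] by metis
    define S where "S = (\<lambda>t. x + t *\<^sub>R v) ` {0..<Inf T}"
    have pos: "0 < Inf T" using t0 False by (auto simp: T_def less_le)
    have S: "S \<subseteq> inside C"
    proof (rule connected_subset_inside[OF _ _ _ xi])
      show "connected S" unfolding S_def
        by (intro connected_continuous_image continuous_intros) (auto simp: is_interval_connected)
      show "S \<inter> C = {}" unfolding S_def
        using cInf_lower[OF _ bd] by (force simp: T_def)
      show "x \<in> S" unfolding S_def using pos by (intro image_eqI[of _ _ 0]) auto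
    qed
    let ?S = "(\<lambda>t. x + t *\<^sub>R v) ` {0..Inf T}"
    have "?S \<subseteq> S \<union> C"
    proof
      fix y assume "y \<in> ?S"
      then obtain t where "y = x + t *\<^sub>R v" "t \<in> {0..Inf T}" by (rule imageE)
      then show "y \<in> S \<union> C" using t0 by (cases "t = Inf T") (auto simp: S_def T_def)
    qed
    moreover have "?S \<subseteq> ?H" using x by (auto simp: inner_add_right intro!: add_nonneg_nonneg)
    moreover have "connected ?S"
      by (intro connected_continuous_image continuous_intros) auto
    moreover have "x \<in> ?S" using pos by (intro image_eqI[of _ _ 0]) auto
    moreover have "x + Inf T *\<^sub>R v \<in> ?S \<inter> C" using t0 by (auto simp: T_def)
    ultimately show ?thesis using S by (intro exI[of _ ?S]) blast
  qed
  then obtain \<S> where \<S>: "\<And>x. x \<in> (C \<union> inside C) \<inter> ?H \<Longrightarrow>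
      connected (\<S> x) \<and> x \<in> \<S> x \<and> \<S> x \<subseteq> (C \<union> inside C) \<inter> ?H \<and> \<S> x \<inter> C \<noteq> {}"
    by metis
  show ?thesis
  proof (cases "(C \<union> inside C) \<inter> ?H = {}")
    case False
    then obtain a where a: "a \<in> C \<inter> ?H" using \<S> by blast
    \<comment> \<open>Each connecting piece is enlarged by \<open>C \<inter> ?H\<close>, so that all
      pieces share the point \<open>a\<close>.\<close>
    have "(C \<union> inside C) \<inter> ?H = (\<Union>x\<in>(C \<union> inside C) \<inter> ?H. \<S> x \<union> (C \<inter> ?H))"
      using \<S> a by blast
    moreover have "connected (\<Union>x\<in>(C \<union> inside C) \<inter> ?H. \<S> x \<union> (C \<inter> ?H))"
    proof (rule connected_Union)
      show "connected S" if "S \<in> (\<lambda>x. \<S> x \<union> (C \<inter> ?H)) ` ((C \<union> inside C) \<inter> ?H)" for S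
        using that \<S> conn by (auto intro!: connected_Un)
      show "\<Inter> ((\<lambda>x. \<S> x \<union> (C \<inter> ?H)) ` ((C \<union> inside C) \<inter> ?H)) \<noteq> {}"
        using a by blast
    qed
    ultimately show ?thesis by simp
  qed simp
qed

text \<open>Unicoherence, transferred from the complex plane along the coordinate
  homeomorphism.\<close>

lemma Janiszewski_dual_plane:
  fixes S T :: "(real^2) set"
  assumes "compact S" "compact T" "connected S" "connected T" "connected (- (S \<union> T))"
  shows "connected (S \<inter> T)"
proof -
  define h :: "real^2 \<Rightarrow> complex" where "h x = Complex (x $ 1) (x $ 2)" for x
  define h' :: "complex \<Rightarrow> real^2" where "h' z = vector [Re z, Im z]" for z
  have hh: "h (h' z) = z" "h' (h x) = x" for z x
    by (auto simp: h_def h'_def complex_eq_iff intro!: vec2_eqI)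
  have "bij h" by (rule bij_betw_byWitness[of _ h']) (auto simp: hh)
  have ch: "continuous_on A h" for A
    unfolding h_def Complex_eq by (intro continuous_intros)
  have "h' = (\<lambda>z. Re z *\<^sub>R axis 1 1 + Im z *\<^sub>R axis 2 1)"
    by (rule ext, rule vec2_eqI) (auto simp: h'_def axis_def)
  then have ch': "continuous_on A h'" for A
    by (simp, intro continuous_intros)
  have "connected (h ` S \<inter> h ` T)"
  proof (rule Janiszewski_dual)
    have "- (h ` S \<union> h ` T) = h ` (- (S \<union> T))"
      using \<open>bij h\<close> by (metis bij_image_Compl_eq image_Un)
    then show "connected (- (h ` S \<union> h ` T))"
      using assms(5) ch by (metis connected_continuous_image)
  qed (use assms ch in \<open>auto intro: compact_continuous_image connected_continuous_image\<close>)
  then have "connected (h ` (S \<inter> T))"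
    using \<open>bij h\<close> by (simp add: bij_is_inj image_Int)
  then have "connected (h' ` h ` (S \<inter> T))"
    using ch' connected_continuous_image by blast
  then show ?thesis by (simp add: image_image hh)
qed

text \<open>The upper and lower halves of the filled set are compact and connected, and the
  complement of their union is the connected set \<open>outside C\<close>. By unicoherence their
  intersection, the trace of the filled set on the axis, is connected, so it contains everything
  between \<open>a\<close> and \<open>b\<close>.\<close>

lemma axis_segment_filled:
  fixes C :: "(real^2) set"
  assumes C: "compact C"
    and up: "connected (C \<inter> {x. 0 \<le> x $ 2})" and low: "connected (C \<inter> {x. x $ 2 \<le> 0})"
    and ab: "a \<in> C" "a $ 2 = 0" "b \<in> C" "b $ 2 = 0"
    and p: "p $ 2 = 0" "a $ 1 \<le> p $ 1" "p $ 1 \<le> b $ 1"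
  shows "p \<in> C \<union> inside C"
proof -
  let ?\<Omega> = "C \<union> inside C"
  let ?e = "axis 2 1 :: real^2"
  have bC: "bounded C" using C by (rule compact_imp_bounded)
  have e: "?e \<bullet> x = x $ 2" "(- ?e) \<bullet> x = - (x $ 2)" "?e \<noteq> 0" "- ?e \<noteq> 0" for x :: "real^2"
    by (auto simp: inner_axis' axis_eq_0_iff)
  have cl: "closed ?\<Omega>"
    unfolding union_with_inside using open_outside[OF compact_imp_closed[OF C]] by (simp only: closed_def double_complement)
  have bd: "bounded ?\<Omega>" using bC bounded_inside by simp
  have cpt: "compact (?\<Omega> \<inter> {x. 0 \<le> x $ 2})" "compact (?\<Omega> \<inter> {x. x $ 2 \<le> 0})"
    using cl bd by (auto simp: compact_eq_bounded_closed
      intro!: bounded_Int closed_Int closed_Collect_le continuous_intros)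
  have cu: "connected (?\<Omega> \<inter> {x. 0 \<le> x $ 2})"
    using connected_filled_Int_halfspace[OF C e(3)] up by (simp add: e)
  have cd: "connected (?\<Omega> \<inter> {x. x $ 2 \<le> 0})"
    using connected_filled_Int_halfspace[OF C e(4)] low by (simp add: e)
  have "?\<Omega> \<inter> {x. 0 \<le> x $ 2} \<union> ?\<Omega> \<inter> {x. x $ 2 \<le> 0} = ?\<Omega>" by force
  then have "connected (- (?\<Omega> \<inter> {x. 0 \<le> x $ 2} \<union> ?\<Omega> \<inter> {x. x $ 2 \<le> 0}))"
    using connected_outside[OF bC] by (simp add: union_with_inside)
  from Janiszewski_dual_plane[OF cpt cu cd this]
  have "connected (?\<Omega> \<inter> {x. x $ 2 = 0})"
    by (rule back_subst[of connected]) force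
  then have "connected ((\<lambda>x. x $ 1) ` (?\<Omega> \<inter> {x. x $ 2 = 0}))"
    by (intro connected_continuous_image continuous_intros)
  then have "p $ 1 \<in> (\<lambda>x. x $ 1) ` (?\<Omega> \<inter> {x. x $ 2 = 0})"
    using connected_contains_Icc[of _ "a $ 1" "b $ 1"] ab p by fastforce
  then obtain q where "q \<in> ?\<Omega>" "q $ 2 = 0" "p $ 1 = q $ 1" by blast
  then have "q = p" using p by (intro vec2_eqI) auto
  then show ?thesis using \<open>q \<in> ?\<Omega>\<close> by simp
qed

subsection \<open>The affine pieces and their iterates\<close>

lemma affine_piece_nth [simp]:
  "affine_piece \<tau> \<delta> x $ 1 = \<tau> * x $ 1 + x $ 2 + 1"
  "affine_piece \<tau> \<delta> x $ 2 = - \<delta> * x $ 1"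
  by (auto simp: affine_piece_def matrix_vector_mult_def sum_2)

lemma affine_piece_convex_combination:
  "affine_piece \<tau> \<delta> ((1 - u) *\<^sub>R x + u *\<^sub>R y)
     = (1 - u) *\<^sub>R affine_piece \<tau> \<delta> x + u *\<^sub>R affine_piece \<tau> \<delta> y"
  by (rule vec2_eqI) (auto simp: algebra_simps)

lemma affine_piece_closed_segment:
  "affine_piece \<tau> \<delta> ` closed_segment x y
     = closed_segment (affine_piece \<tau> \<delta> x) (affine_piece \<tau> \<delta> y)"
  by (force simp: closed_segment_def affine_piece_convex_combination image_iff)

lemma affine_piece_inject:
  "\<delta> \<noteq> 0 \<Longrightarrow> affine_piece \<tau> \<delta> x = affine_piece \<tau> \<delta> y \<longleftrightarrow> x = y"
  by (auto simp: vec_eq_iff forall_2)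

text \<open>Lucas sequences of the first kind. Two consecutive terms form the first row of a power
  of the linear part, and the partial sums give the translation term.\<close>

fun lucas :: "real \<Rightarrow> real \<Rightarrow> nat \<Rightarrow> real" where
  "lucas \<tau> \<delta> 0 = 0"
| "lucas \<tau> \<delta> (Suc 0) = 1"
| "lucas \<tau> \<delta> (Suc (Suc k)) = \<tau> * lucas \<tau> \<delta> (Suc k) - \<delta> * lucas \<tau> \<delta> k"

definition lucas_sum :: "real \<Rightarrow> real \<Rightarrow> nat \<Rightarrow> real" where
  "lucas_sum \<tau> \<delta> k = (\<Sum>i\<le>k. lucas \<tau> \<delta> i)"

lemma lucas_sum_simps [simp]:
  "lucas_sum \<tau> \<delta> 0 = 0"
  "lucas_sum \<tau> \<delta> (Suc k) = lucas_sum \<tau> \<delta> k + lucas \<tau> \<delta> (Suc k)"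
  by (auto simp: lucas_sum_def)

lemma affine_piece_funpow_1:
  "(affine_piece \<tau> \<delta> ^^ k) x $ 1 =
     lucas \<tau> \<delta> (Suc k) * x $ 1 + lucas \<tau> \<delta> k * x $ 2 + lucas_sum \<tau> \<delta> k"
proof (induction k arbitrary: x)
  case (Suc k)
  show ?case
    by (simp only: funpow_Suc_right o_apply Suc.IH) (simp add: algebra_simps)
qed simp

lemma lucas_sum_rec:
  "lucas_sum \<tau> \<delta> (Suc (Suc k)) = \<tau> * lucas_sum \<tau> \<delta> (Suc k) - \<delta> * lucas_sum \<tau> \<delta> k + 1"
  by (induction k) (auto simp: algebra_simps)

text \<open>The point \<open>- lucas_sum k / lucas k\<close> of the switching line is mapped into the switching line
  by the \<open>k\<close>-th iterate. The following Wronskian compares consecutive such points.\<close>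

definition lucas_wronskian :: "real \<Rightarrow> real \<Rightarrow> nat \<Rightarrow> real" where
  "lucas_wronskian \<tau> \<delta> k =
     lucas_sum \<tau> \<delta> (Suc k) * lucas \<tau> \<delta> k - lucas_sum \<tau> \<delta> k * lucas \<tau> \<delta> (Suc k)"

lemma lucas_wronskian_Suc:
  "lucas_wronskian \<tau> \<delta> (Suc k) = \<delta> * lucas_wronskian \<tau> \<delta> k + lucas \<tau> \<delta> (Suc k)"
proof -
  have "lucas_wronskian \<tau> \<delta> (Suc k)
      = (\<tau> * lucas_sum \<tau> \<delta> (Suc k) - \<delta> * lucas_sum \<tau> \<delta> k + 1) * lucas \<tau> \<delta> (Suc k)
        - lucas_sum \<tau> \<delta> (Suc k) * (\<tau> * lucas \<tau> \<delta> (Suc k) - \<delta> * lucas \<tau> \<delta> k)"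
    unfolding lucas_wronskian_def lucas_sum_rec by simp
  then show ?thesis
    unfolding lucas_wronskian_def by (simp add: algebra_simps)
qed

text \<open>The determinant of \<open>(A d, d)\<close>, where \<open>A\<close> is the linear part of the affine piece; it is
  positive when the orbit polygon turns clockwise.\<close>

definition turn :: "real \<Rightarrow> real \<Rightarrow> real^2 \<Rightarrow> real" where
  "turn \<tau> \<delta> d = (d $ 2)\<^sup>2 + \<tau> * d $ 1 * d $ 2 + \<delta> * (d $ 1)\<^sup>2"

text \<open>Replacing \<open>d\<close> by \<open>A d\<close> in the determinant of
  \<open>(A d, d)\<close> multiplies it by the determinant of \<open>A\<close>, which is
  \<open>\<delta>\<close>.\<close>

lemma turn_affine_piece:
  "turn \<tau> \<delta> (affine_piece \<tau> \<delta> x - affine_piece \<tau> \<delta> y) = \<delta> * turn \<tau> \<delta> (x - y)"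
  by (simp add: turn_def) (algebra)

text \<open>As \<open>\<delta> * a\<^sup>2\<close> is positive, a nonpositive \<open>turn\<close>
  forces \<open>b * (\<tau> * a + b) < 0\<close>, whose second factor is the first coordinate of the
  next edge. So an edge pointing right and down is followed by another such edge.\<close>

lemma turn_le_0_forward:
  assumes "\<delta> > 0" "turn \<tau> \<delta> (x - y) \<le> 0" "(x - y) $ 1 > 0" "(x - y) $ 2 < 0"
  shows "turn \<tau> \<delta> (affine_piece \<tau> \<delta> x - affine_piece \<tau> \<delta> y) \<le> 0"
    and "(affine_piece \<tau> \<delta> x - affine_piece \<tau> \<delta> y) $ 1 > 0"
    and "(affine_piece \<tau> \<delta> x - affine_piece \<tau> \<delta> y) $ 2 < 0"
proof -
  define a b where "a = (x - y) $ 1" and "b = (x - y) $ 2"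
  have "0 < \<delta> * a\<^sup>2" using assms by (simp add: a_def)
  moreover have "b\<^sup>2 + \<tau> * a * b + \<delta> * a\<^sup>2 \<le> 0" using assms(2) by (simp only: turn_def a_def b_def)
  ultimately have "b * (\<tau> * a + b) < 0" by (simp add: algebra_simps power2_eq_square)
  then have "\<tau> * a + b > 0" using assms(4) by (simp add: b_def mult_less_0_iff)
  then show "(affine_piece \<tau> \<delta> x - affine_piece \<tau> \<delta> y) $ 1 > 0" by (simp add: a_def b_def algebra_simps)
  show "(affine_piece \<tau> \<delta> x - affine_piece \<tau> \<delta> y) $ 2 < 0" using assms by simp
  show "turn \<tau> \<delta> (affine_piece \<tau> \<delta> x - affine_piece \<tau> \<delta> y) \<le> 0"
    unfolding turn_affine_piece using assms by (simp add: mult_nonneg_nonpos)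
qed

text \<open>The same inequality read backwards: now the second factor is known to be positive, which
  forces \<open>b < 0\<close>.\<close>

lemma turn_le_0_backward:
  assumes "\<delta> > 0" "turn \<tau> \<delta> (affine_piece \<tau> \<delta> x - affine_piece \<tau> \<delta> y) \<le> 0"
    "(affine_piece \<tau> \<delta> x - affine_piece \<tau> \<delta> y) $ 1 > 0"
    "(affine_piece \<tau> \<delta> x - affine_piece \<tau> \<delta> y) $ 2 < 0"
  shows "turn \<tau> \<delta> (x - y) \<le> 0" "(x - y) $ 1 > 0" "(x - y) $ 2 < 0"
proof -
  define a b where "a = (x - y) $ 1" and "b = (x - y) $ 2"
  show t: "turn \<tau> \<delta> (x - y) \<le> 0"
    using assms(1,2) unfolding turn_affine_piece by (simp add: mult_le_0_iff)
  show a: "(x - y) $ 1 > 0" using assms(1,4) by (simp add: algebra_simps)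
  have "\<tau> * a + b > 0" using assms(3) by (simp add: a_def b_def algebra_simps)
  moreover have "0 < \<delta> * a\<^sup>2" using assms a by (simp add: a_def)
  moreover have "b\<^sup>2 + \<tau> * a * b + \<delta> * a\<^sup>2 \<le> 0" using t by (simp only: turn_def a_def b_def)
  ultimately have "b * (\<tau> * a + b) < 0" by (simp add: algebra_simps power2_eq_square)
  then have "b < 0" using \<open>\<tau> * a + b > 0\<close> by (simp add: mult_less_0_iff)
  then show "(x - y) $ 2 < 0" by (simp add: b_def)
qed

subsection \<open>The normal form as a homeomorphism\<close>

text \<open>The first coordinate \<open>a\<close> of the preimage has the opposite sign to
  \<open>y $ 2\<close>, so \<open>min\<close> and \<open>max\<close> can select the branch without a
  case distinction, which keeps continuity immediate.\<close>

definition bcnf_inv :: "real \<Rightarrow> real \<Rightarrow> real \<Rightarrow> real \<Rightarrow> real^2 \<Rightarrow> real^2" where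
  "bcnf_inv \<tau>\<^sub>L \<delta>\<^sub>L \<tau>\<^sub>R \<delta>\<^sub>R y =
     (let a = - max (y $ 2) 0 / \<delta>\<^sub>L - min (y $ 2) 0 / \<delta>\<^sub>R
      in a *\<^sub>R axis 1 1 + (y $ 1 - 1 - \<tau>\<^sub>L * min a 0 - \<tau>\<^sub>R * max a 0) *\<^sub>R axis 2 1)"

lemma bcnf_eq_min_max:
  "bcnf \<tau>\<^sub>L \<delta>\<^sub>L \<tau>\<^sub>R \<delta>\<^sub>R x =
     (\<tau>\<^sub>L * min (x $ 1) 0 + \<tau>\<^sub>R * max (x $ 1) 0 + x $ 2 + 1) *\<^sub>R axis 1 1
     + (- \<delta>\<^sub>L * min (x $ 1) 0 - \<delta>\<^sub>R * max (x $ 1) 0) *\<^sub>R axis 2 1"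
  by (rule vec2_eqI) (auto simp: bcnf_def axis_def min_def max_def)

lemma continuous_on_bcnf: "continuous_on A (bcnf \<tau>\<^sub>L \<delta>\<^sub>L \<tau>\<^sub>R \<delta>\<^sub>R)"
  unfolding bcnf_eq_min_max by (intro continuous_intros)

lemma continuous_on_bcnf_inv:
  "\<delta>\<^sub>L \<noteq> 0 \<Longrightarrow> \<delta>\<^sub>R \<noteq> 0 \<Longrightarrow> continuous_on A (bcnf_inv \<tau>\<^sub>L \<delta>\<^sub>L \<tau>\<^sub>R \<delta>\<^sub>R)"
  unfolding bcnf_inv_def Let_def by (intro continuous_intros) auto

lemma bcnf_bcnf_inv:
  assumes "\<delta>\<^sub>L > 0" "\<delta>\<^sub>R > 0"
  shows "bcnf \<tau>\<^sub>L \<delta>\<^sub>L \<tau>\<^sub>R \<delta>\<^sub>R (bcnf_inv \<tau>\<^sub>L \<delta>\<^sub>L \<tau>\<^sub>R \<delta>\<^sub>R y) = y"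
  using assms by (cases "y $ 2 \<ge> 0"; intro vec2_eqI)
    (auto simp: bcnf_def bcnf_inv_def axis_def Let_def min_def max_def field_simps mult_le_0_iff)

lemma bcnf_inv_bcnf:
  assumes "\<delta>\<^sub>L > 0" "\<delta>\<^sub>R > 0"
  shows "bcnf_inv \<tau>\<^sub>L \<delta>\<^sub>L \<tau>\<^sub>R \<delta>\<^sub>R (bcnf \<tau>\<^sub>L \<delta>\<^sub>L \<tau>\<^sub>R \<delta>\<^sub>R x) = x"
  using assms by (cases "x $ 1 \<ge> 0"; intro vec2_eqI)
    (auto simp: bcnf_def bcnf_inv_def axis_def Let_def min_def max_def field_simps mult_le_0_iff
      zero_le_mult_iff)

lemma bij_bcnf: "\<delta>\<^sub>L > 0 \<Longrightarrow> \<delta>\<^sub>R > 0 \<Longrightarrow> bij (bcnf \<tau>\<^sub>L \<delta>\<^sub>L \<tau>\<^sub>R \<delta>\<^sub>R)"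
  by (rule bij_betw_byWitness[of _ "bcnf_inv \<tau>\<^sub>L \<delta>\<^sub>L \<tau>\<^sub>R \<delta>\<^sub>R"])
    (auto simp: bcnf_bcnf_inv bcnf_inv_bcnf)

section \<open>Integer iterates of a bijection\<close>

lemma int_iter_Suc:
  assumes "bij f"
  shows "f (int_iter f k x) = int_iter f (k + 1) x"
proof (cases "k \<ge> 0")
  case True
  then have "nat (k + 1) = Suc (nat k)" by simp
  with True show ?thesis by (simp add: int_iter_def)
next
  case False
  then have "nat (- k) = Suc (nat (- (k + 1)))" by simp
  then have "f (int_iter f k x) = f (inv f ((inv f ^^ nat (- (k + 1))) x))"
    using False by (simp add: int_iter_def)
  also have "\<dots> = (inv f ^^ nat (- (k + 1))) x"
    using assms by (simp add: bij_is_surj surj_f_inv_f)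
  finally show ?thesis using False by (auto simp: int_iter_def)
qed

lemma int_iter_minus_funpow:
  assumes "bij f"
  shows "int_iter f (- int m) ((f ^^ m) x) = x"
proof -
  have "(inv f ^^ m) ((f ^^ m) x) = x"
    using assms by (metis bij_fn bij_is_inj inv_f_f inv_fn)
  then show ?thesis by (cases "m = 0") (auto simp: int_iter_def)
qed

lemma closed_segmentE:
  assumes "x \<in> closed_segment a b"
  obtains u where "0 \<le> u" "u \<le> 1" "x = (1 - u) *\<^sub>R a + u *\<^sub>R b"
  using assms by (auto simp: closed_segment_def)

subsection \<open>The orbit polygon\<close>

text \<open>Here \<open>n\<close> is \<open>\<ell> - 1\<close>, so that \<open>P (- n)\<close> is the paper's \<open>V\<close> and \<open>P r\<close> its \<open>Z\<close>.\<close>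

locale bcnf_orbit =
  fixes \<tau>\<^sub>L \<delta>\<^sub>L \<tau>\<^sub>R \<delta>\<^sub>R \<beta> :: real and n r :: nat and P :: "int \<Rightarrow> real^2"
  assumes \<delta>\<^sub>L: "\<delta>\<^sub>L > 0" and \<delta>\<^sub>R: "\<delta>\<^sub>R > 0" and \<beta>: "\<beta> > 0"
    and n: "1 \<le> n" and r: "2 \<le> r"
    and P_0: "P 0 = vector [0, \<beta>]"
    and orbit: "bcnf \<tau>\<^sub>L \<delta>\<^sub>L \<tau>\<^sub>R \<delta>\<^sub>R (P k) = P (k + 1)"
    and P_right: "1 \<le> k \<Longrightarrow> k < int r \<Longrightarrow> 0 < P k $ 1"
    and P_r_1: "P (int r) $ 1 \<le> 0"
    and P_left: "- int n \<le> k \<Longrightarrow> k < 0 \<Longrightarrow> P k $ 1 < 0"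
    and V_2: "P (- int n) $ 2 \<le> 0"
begin

abbreviation f :: "real^2 \<Rightarrow> real^2" where "f \<equiv> bcnf \<tau>\<^sub>L \<delta>\<^sub>L \<tau>\<^sub>R \<delta>\<^sub>R"
abbreviation fL :: "real^2 \<Rightarrow> real^2" where "fL \<equiv> affine_piece \<tau>\<^sub>L \<delta>\<^sub>L"
abbreviation fR :: "real^2 \<Rightarrow> real^2" where "fR \<equiv> affine_piece \<tau>\<^sub>R \<delta>\<^sub>R"
abbreviation V :: "real^2" where "V \<equiv> P (- int n)"
abbreviation Z :: "real^2" where "Z \<equiv> P (int r)"
abbreviation e :: "nat \<Rightarrow> real" where "e \<equiv> lucas \<tau>\<^sub>L \<delta>\<^sub>L"
abbreviation c :: "nat \<Rightarrow> real" where "c \<equiv> lucas_sum \<tau>\<^sub>L \<delta>\<^sub>L"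

section \<open>First coordinates of the iterates of the left piece\<close>

definition g :: "nat \<Rightarrow> real^2 \<Rightarrow> real" where
  "g k x = (fL ^^ k) x $ 1"

lemma g_eq: "g k x = e (Suc k) * x $ 1 + e k * x $ 2 + c k"
  by (simp add: g_def affine_piece_funpow_1)

lemma g_0 [simp]: "g 0 x = x $ 1"
  by (simp add: g_def)

lemma g_Suc: "g (Suc k) x = g k (fL x)"
  by (simp add: g_def funpow_Suc_right del: funpow.simps)

lemma g_convex_combination: "g k ((1 - u) *\<^sub>R x + u *\<^sub>R y) = (1 - u) * g k x + u * g k y"
  by (simp add: g_eq algebra_simps)

lemma f_left: "x $ 1 \<le> 0 \<Longrightarrow> f x = fL x"
  by (simp add: bcnf_def)

lemma f_right: "0 \<le> x $ 1 \<Longrightarrow> f x = fR x"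
  by (cases "x $ 1 = 0") (auto simp: bcnf_def intro!: vec2_eqI)

lemma P_0_nth [simp]: "P 0 $ 1 = 0" "P 0 $ 2 = \<beta>"
  by (auto simp: P_0)

lemma P_nonpos: "- int n \<le> k \<Longrightarrow> k \<le> 0 \<Longrightarrow> P k $ 1 \<le> 0"
  using P_left[of k] by (cases "k = 0") auto

lemma P_nonneg: "0 \<le> k \<Longrightarrow> k < int r \<Longrightarrow> 0 \<le> P k $ 1"
  using P_right[of k] by (cases "k = 0") auto

lemma fL_P: "- int n \<le> k \<Longrightarrow> k \<le> 0 \<Longrightarrow> fL (P k) = P (k + 1)"
  using P_nonpos orbit f_left by metis

lemma fR_P: "0 \<le> k \<Longrightarrow> k < int r \<Longrightarrow> fR (P k) = P (k + 1)"
  using P_nonneg orbit f_right by metis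

lemma P_1_nth [simp]: "P 1 $ 1 = \<beta> + 1" "P 1 $ 2 = 0"
  using fL_P[of 0] P_0_nth by (metis add.left_neutral add.commute affine_piece_nth mult_zero_right
      neg_le_0_iff_le of_nat_0_le_iff order_refl mult_zero_left)+

lemma P_upper: "- int n < k \<Longrightarrow> k \<le> 0 \<Longrightarrow> 0 < P k $ 2"
  using fL_P[of "k - 1"] P_left[of "k - 1"] \<delta>\<^sub>L affine_piece_nth(2)[of \<tau>\<^sub>L \<delta>\<^sub>L "P (k - 1)"]
  by (simp add: mult_pos_neg)

lemma P_lower: "2 \<le> k \<Longrightarrow> k \<le> int r \<Longrightarrow> P k $ 2 < 0"
  using fR_P[of "k - 1"] P_right[of "k - 1"] \<delta>\<^sub>R affine_piece_nth(2)[of \<tau>\<^sub>R \<delta>\<^sub>R "P (k - 1)"]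
  by simp

lemma Z_2: "Z $ 2 < 0"
  using P_lower[of "int r"] r by simp

lemma fL_funpow_P: "j \<le> n \<Longrightarrow> k \<le> Suc j \<Longrightarrow> (fL ^^ k) (P (- int j)) = P (int k - int j)"
proof (induction k)
  case (Suc k)
  then show ?case using fL_P[of "int k - int j"] by (simp add: algebra_simps)
qed simp

text \<open>The bound is 1 and not 0 because \<open>P 0\<close> lies on the switching line, where
  the left piece still agrees with \<open>f\<close>.\<close>

lemma g_P: "- int n \<le> i \<Longrightarrow> i \<le> 0 \<Longrightarrow> int k + i \<le> 1 \<Longrightarrow> g k (P i) = P (int k + i) $ 1"
  using fL_funpow_P[of "nat (- i)" k] by (simp add: g_def algebra_simps)

text \<open>For \<open>k < n\<close>, \<open>P (- k)\<close> reaches the switching line after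
  \<open>k\<close> steps, so \<open>e (Suc k) * P (- k) $ 1\<close> equals minus
  \<open>e k * P (- k) $ 2 + c k\<close>, which is negative by induction. As \<open>P (- k)\<close>
  is on the left for \<open>k \<ge> 1\<close>, \<open>e (Suc k)\<close> is positive.\<close>

lemma lucas_pos: "1 \<le> k \<Longrightarrow> k \<le> n \<Longrightarrow> 0 < e k"
  and lucas_sum_pos: "1 \<le> k \<Longrightarrow> k \<le> n \<Longrightarrow> 0 < c k"
proof -
  have "1 \<le> k \<Longrightarrow> k \<le> n \<Longrightarrow> 0 < e k \<and> 0 < c k" for k
  proof (induction k rule: nat_induct_at_least)
    case (Suc k)
    then have IH: "0 < e k" "0 < c k" by auto
    have "g k (P (- int k)) = 0" using Suc g_P[of "- int k" k] by simp
    then have "e (Suc k) * P (- int k) $ 1 = - (e k * P (- int k) $ 2 + c k)"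
      by (simp add: g_eq)
    also have "\<dots> < 0" using IH Suc P_upper[of "- int k"]
      by (smt (verit) mult_pos_pos Suc_le_eq of_nat_less_iff neg_less_iff_less neg_le_0_iff_le of_nat_0_le_iff)
    finally have "0 < e (Suc k)"
      using P_left[of "- int k"] Suc by (simp add: mult_less_0_iff)
    then show ?case using IH by simp
  qed auto
  then show "1 \<le> k \<Longrightarrow> k \<le> n \<Longrightarrow> 0 < e k" "1 \<le> k \<Longrightarrow> k \<le> n \<Longrightarrow> 0 < c k" by auto
qed

lemma lucas_nonneg: "k \<le> n \<Longrightarrow> 0 \<le> e k"
  using lucas_pos[of k] by (cases "k = 0") auto

lemma lucas_wronskian_pos: "1 \<le> k \<Longrightarrow> k \<le> n \<Longrightarrow> 0 < lucas_wronskian \<tau>\<^sub>L \<delta>\<^sub>L k"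
proof (induction k rule: nat_induct_at_least)
  case base
  then show ?case by (simp add: lucas_wronskian_def)
next
  case (Suc k)
  then show ?case
    using lucas_pos[of "Suc k"] \<delta>\<^sub>L by (simp add: lucas_wronskian_Suc add_pos_pos)
qed

lemma lucas_wronskian_nonneg: "k \<le> n \<Longrightarrow> 0 \<le> lucas_wronskian \<tau>\<^sub>L \<delta>\<^sub>L k"
  using lucas_wronskian_pos[of k] by (cases "k = 0") (auto simp: lucas_wronskian_def)

text \<open>On the switching line \<open>g k\<close> is positive exactly above height
  \<open>- c k / e k\<close>, and nonnegative Wronskians say that these heights do not increase with
  \<open>k\<close>.\<close>

lemma g_Sigma_mono:
  assumes "1 \<le> j" "j \<le> k" "k \<le> n" "y $ 1 = 0" "0 < g j y"
  shows "0 < g k y"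
  using assms(2,3,5)
proof (induction k rule: dec_induct)
  case (step i)
  have pos: "0 < e i" "0 < e (Suc i)" using step assms lucas_pos by auto
  have "0 < e i * y $ 2 + c i" using step assms(4) by (simp add: g_eq)
  then have "0 < (e i * y $ 2 + c i) * e (Suc i)" using pos by simp
  also have "\<dots> = e i * (e (Suc i) * y $ 2 + c (Suc i)) - lucas_wronskian \<tau>\<^sub>L \<delta>\<^sub>L i"
    by (simp add: lucas_wronskian_def algebra_simps del: lucas_sum_simps)
  finally have "0 < e i * (e (Suc i) * y $ 2 + c (Suc i))"
    using lucas_wronskian_nonneg[of i] step by simp
  then show ?case using pos assms(4) by (simp add: g_eq zero_less_mult_iff del: lucas_sum_simps)
qed

text \<open>In the third quadrant, \<open>g k > 0\<close> cuts off the region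
  \<open>e (Suc k) * p + e k * q < c k\<close> near the origin. Two consecutive Wronskians show that
  its intercepts on both axes do not shrink. The bound on \<open>k\<close> is one lower than in
  \<open>g_Sigma_mono\<close> because \<open>e (Suc k)\<close> now matters.\<close>

lemma g_quadrant_mono:
  assumes "1 \<le> j" "j \<le> k" "Suc k \<le> n" "y $ 1 \<le> 0" "y $ 2 \<le> 0" "0 < g j y"
  shows "0 < g k y"
  using assms(2,3,6)
proof (induction k rule: dec_induct)
  case (step i)
  have pos: "0 < e i" "0 < e (Suc i)" "0 < e (Suc (Suc i))" "0 < c i" "0 < c (Suc i)"
    using step assms lucas_pos[of i] lucas_pos[of "Suc i"] lucas_pos[of "Suc (Suc i)"]
      lucas_sum_pos[of i] lucas_sum_pos[of "Suc i"]
    by (simp_all del: lucas.simps lucas_sum_simps)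
  define p q where "p = - (y $ 1)" and "q = - (y $ 2)"
  have pq: "0 \<le> p" "0 \<le> q" using assms by (auto simp: p_def q_def)
  have W: "0 \<le> lucas_wronskian \<tau>\<^sub>L \<delta>\<^sub>L i" "0 \<le> lucas_wronskian \<tau>\<^sub>L \<delta>\<^sub>L (Suc i)"
    using lucas_wronskian_nonneg step by auto
  have "e (Suc i) * p + e i * q < c i"
    using step by (simp add: g_eq p_def q_def)
  then have "(e (Suc i) * p + e i * q) * c (Suc i) < c i * c (Suc i)" using pos by simp
  moreover have "c i * e (Suc (Suc i)) * p \<le> c (Suc i) * e (Suc i) * p"
  proof (intro mult_right_mono pq)
    show "c i * e (Suc (Suc i)) \<le> c (Suc i) * e (Suc i)"
      using W(2) pos by (simp add: lucas_wronskian_def algebra_simps)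
  qed
  moreover have "c i * e (Suc i) * q \<le> c (Suc i) * e i * q"
    using W(1) by (intro mult_right_mono pq) (simp add: lucas_wronskian_def)
  ultimately have "c i * (e (Suc (Suc i)) * p + e (Suc i) * q) < c i * c (Suc i)"
    by (simp only: algebra_simps)
  then have "e (Suc (Suc i)) * p + e (Suc i) * q < c (Suc i)"
    using pos by (simp only: mult_less_cancel_left_pos)
  then show ?case by (simp add: g_eq p_def q_def)
qed

section \<open>The turning direction of the left and right chains\<close>

abbreviation D :: "real^2" where "D \<equiv> P (1 - int n) - V"

lemma fL_V: "fL V = P (1 - int n)"
  using fL_P[of "- int n"] by (simp add: add.commute)

lemma D_2: "0 < D $ 2"
  using P_upper[of "1 - int n"] V_2 n by simp

text \<open>If the polygon turned the other way at \<open>P 0\<close>, then its backward continuation would move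
  away from the switching line for ever.\<close>

lemma turn_left: "0 < turn \<tau>\<^sub>L \<delta>\<^sub>L D"
proof -
  let ?D = "\<lambda>k. P (1 - int k) - P (- int k)"
  have step: "?D k = fL (P (1 - int (Suc k))) - fL (P (- int (Suc k)))" if "Suc k \<le> n" for k
    using that fL_P[of "- int k"] fL_P[of "- int (Suc k)"] by (simp add: algebra_simps)
  have scale: "k \<le> n \<Longrightarrow> turn \<tau>\<^sub>L \<delta>\<^sub>L (?D 0) = \<delta>\<^sub>L ^ k * turn \<tau>\<^sub>L \<delta>\<^sub>L (?D k)" for k
  proof (induction k)
    case (Suc k)
    then show ?case unfolding step[OF Suc.prems] by (simp only: turn_affine_piece) simp
  qed simp
  have "0 < turn \<tau>\<^sub>L \<delta>\<^sub>L (?D 0)"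
  proof (rule ccontr)
    assume neg: "\<not> 0 < turn \<tau>\<^sub>L \<delta>\<^sub>L (?D 0)"
    \<comment> \<open>The edge from \<open>P 0\<close> to \<open>P 1\<close> points right and down;
      then so would every earlier edge back to \<open>D\<close>, but \<open>D\<close> points
      up.\<close>
    have "k \<le> n \<Longrightarrow> turn \<tau>\<^sub>L \<delta>\<^sub>L (?D k) \<le> 0 \<and> 0 < ?D k $ 1 \<and> ?D k $ 2 < 0" for k
    proof (induction k)
      case 0
      then show ?case using neg \<beta> by simp
    next
      case (Suc k)
      then show ?case
        using turn_le_0_backward[OF \<delta>\<^sub>L, of \<tau>\<^sub>L "P (1 - int (Suc k))" "P (- int (Suc k))"]
          step[OF Suc.prems] by simp
    qed
    from this[of n] D_2 show False by simp
  qed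
  then show ?thesis using scale[of n] \<delta>\<^sub>L by (simp add: zero_less_mult_iff)
qed

text \<open>If the first edge did not turn clockwise, all later edges would point right and down,
  including the last one, which however goes from the open right half-plane to the closed left
  one.\<close>

lemma turn_right: "0 < turn \<tau>\<^sub>R \<delta>\<^sub>R (Z - P (int r - 1))"
proof -
  let ?D = "\<lambda>k. P (int k + 1) - P (int k)"
  have step: "?D (Suc k) = fR (P (int k + 1)) - fR (P (int k))" if "Suc k < r" for k
    using that fR_P[of "int k"] fR_P[of "int k + 1"] by (simp add: algebra_simps)
  have scale: "k < r \<Longrightarrow> turn \<tau>\<^sub>R \<delta>\<^sub>R (?D k) = \<delta>\<^sub>R ^ k * turn \<tau>\<^sub>R \<delta>\<^sub>R (?D 0)" for k
  proof (induction k)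
    case (Suc k)
    then show ?case unfolding step[OF Suc.prems] by (simp only: turn_affine_piece) simp
  qed simp
  have "0 < turn \<tau>\<^sub>R \<delta>\<^sub>R (?D 0)"
  proof (rule ccontr)
    assume neg: "\<not> 0 < turn \<tau>\<^sub>R \<delta>\<^sub>R (?D 0)"
    have "k < r \<Longrightarrow> turn \<tau>\<^sub>R \<delta>\<^sub>R (?D k) \<le> 0 \<and> 0 < ?D k $ 1 \<and> ?D k $ 2 < 0" for k
    proof (induction k)
      case 0
      then show ?case using neg \<beta> by simp
    next
      case (Suc k)
      then show ?case
        using turn_le_0_forward[OF \<delta>\<^sub>R, of \<tau>\<^sub>R "P (int k + 1)" "P (int k)"]
          step[OF Suc.prems] by simp
    qed
    from this[of "r - 1"] have "0 < Z $ 1 - P (int r - 1) $ 1" using r by (simp add: of_nat_diff)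
    then show False using P_r_1 P_right[of "int r - 1"] r by simp
  qed
  then show ?thesis using scale[of "r - 1"] \<delta>\<^sub>R r by (simp add: of_nat_diff)
qed

text \<open>Positive to the right of the line through \<open>V\<close> and \<open>f V\<close>.\<close>

definition side :: "real^2 \<Rightarrow> real" where
  "side x = (x $ 1 - V $ 1) * D $ 2 - (x $ 2 - V $ 2) * D $ 1"

lemma side_convex_combination: "side ((1 - u) *\<^sub>R x + u *\<^sub>R y) = (1 - u) * side x + u * side y"
  by (simp add: side_def algebra_simps)

lemma side_V [simp]: "side V = 0" and side_fV [simp]: "side (P (1 - int n)) = 0"
  by (auto simp: side_def)

lemma side_fL_fV: "side (fL (P (1 - int n))) = turn \<tau>\<^sub>L \<delta>\<^sub>L D"
proof -
  have *: "P (1 - int n) $ 1 = \<tau>\<^sub>L * V $ 1 + V $ 2 + 1" "P (1 - int n) $ 2 = - \<delta>\<^sub>L * V $ 1"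
    unfolding fL_V[symmetric] by simp_all
  show ?thesis
    by (simp add: side_def turn_def * algebra_simps power2_eq_square)
qed

subsection \<open>Edges\<close>

lemma edge_left_1:
  assumes "x \<in> closed_segment (P k) (P (k + 1))" "- int n \<le> k" "k < 0"
  shows "x $ 1 \<le> 0"
  using assms P_nonpos[of k] P_nonpos[of "k + 1"]
  by (auto elim!: closed_segmentE intro!: add_nonpos_nonpos simp: mult_nonneg_nonpos)

lemma edge_right_1:
  assumes "x \<in> closed_segment (P k) (P (k + 1))" "0 \<le> k" "k + 1 < int r"
  shows "0 \<le> x $ 1"
  using assms P_nonneg[of k] P_nonneg[of "k + 1"] by (auto elim!: closed_segmentE)

lemma segment_nth_2_pos:
  fixes a b :: "real^2"
  assumes "x \<in> closed_segment a b" "0 \<le> a $ 2" "0 < b $ 2"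
  shows "0 < x $ 2 \<or> x = a"
proof -
  obtain u where u: "0 \<le> u" "u \<le> 1" "x = (1 - u) *\<^sub>R a + u *\<^sub>R b"
    using assms(1) by (rule closed_segmentE)
  then show ?thesis
    using assms by (cases "u = 0") (auto intro!: add_nonneg_pos)
qed

lemma segment_nth_2_neg:
  fixes a b :: "real^2"
  assumes "x \<in> closed_segment a b" "a $ 2 \<le> 0" "b $ 2 < 0"
  shows "x $ 2 < 0 \<or> x = a"
proof -
  obtain u where u: "0 \<le> u" "u \<le> 1" "x = (1 - u) *\<^sub>R a + u *\<^sub>R b"
    using assms(1) by (rule closed_segmentE)
  then show ?thesis
    using assms by (cases "u = 0") (auto intro!: add_nonpos_neg simp: mult_nonneg_nonpos mult_pos_neg)
qed

lemma edge_upper_2: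
  assumes "x \<in> closed_segment (P k) (P (k + 1))" "- int n < k" "k \<le> 0"
  shows "0 < x $ 2 \<or> x = P 1"
proof (cases "k = 0")
  case True
  then show ?thesis
    using segment_nth_2_pos[of x "P 1" "P 0"] assms \<beta> by (simp add: closed_segment_commute)
next
  case False
  then show ?thesis
    using segment_nth_2_pos[of x "P k" "P (k + 1)"] assms P_upper[of k] P_upper[of "k + 1"] by auto
qed

lemma edge_lower_2:
  assumes "x \<in> closed_segment (P k) (P (k + 1))" "1 \<le> k" "k < int r"
  shows "x $ 2 < 0 \<or> x = P 1"
proof (cases "k = 1")
  case True
  then show ?thesis
    using segment_nth_2_neg[of x "P 1" "P 2"] assms P_lower[of 2] by simp
next
  case False
  then show ?thesis
    using segment_nth_2_neg[of x "P k" "P (k + 1)"] assms P_lower[of k] P_lower[of "k + 1"] by auto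
qed

lemma edge_left_image:
  assumes "- int n \<le> k" "k < 0"
  shows "fL ` closed_segment (P k) (P (k + 1)) = closed_segment (P (k + 1)) (P (k + 2))"
  using fL_P[of k] fL_P[of "k + 1"] assms by (simp add: affine_piece_closed_segment add.assoc)

lemma edge_right_image:
  assumes "0 \<le> k" "k + 1 < int r"
  shows "fR ` closed_segment (P k) (P (k + 1)) = closed_segment (P (k + 1)) (P (k + 2))"
  using fR_P[of k] fR_P[of "k + 1"] assms by (simp add: affine_piece_closed_segment add.assoc)

text \<open>Pulling back by \<open>j\<close> steps reduces to an intersection with the first edge, the only one above
  the horizontal axis.\<close>

lemma right_edges_Int:
  fixes j :: nat and m :: int
  assumes "int j < m" "m < int r"
    and "x \<in> closed_segment (P (int j)) (P (int j + 1))" "x \<in> closed_segment (P m) (P (m + 1))"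
  shows "m = int j + 1 \<and> x = P m"
  using assms
proof (induction j arbitrary: x m)
  case 0
  then have "x = P 1"
    using edge_upper_2[of x 0] edge_lower_2[of x m] n by force
  moreover have "m = 1"
  proof (rule ccontr)
    assume "m \<noteq> 1"
    then have "P m $ 2 < 0" "P (m + 1) $ 2 < 0" using 0 P_lower[of m] P_lower[of "m + 1"] by auto
    then have "x $ 2 < 0" using segment_nth_2_neg[of x "P m" "P (m + 1)"] 0 by auto
    with \<open>x = P 1\<close> show False by simp
  qed
  ultimately show ?case by simp
next
  case (Suc j)
  obtain x' where x': "x' \<in> closed_segment (P (int j)) (P (int j + 1))" "x = fR x'"
    using Suc.prems edge_right_image[of "int j"] by (force simp: algebra_simps)
  obtain x'' where x'': "x'' \<in> closed_segment (P (m - 1)) (P (m - 1 + 1))" "x = fR x''"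
    using Suc.prems edge_right_image[of "m - 1"] by (force simp: algebra_simps)
  have "x'' = x'" using x' x'' \<delta>\<^sub>R affine_piece_inject[of \<delta>\<^sub>R] by (metis less_irrefl)
  then have "m - 1 = int j + 1 \<and> x' = P (m - 1)"
    using Suc.IH[of "m - 1" x'] x' x'' Suc.prems by auto
  then show ?case using x' fR_P[of "m - 1"] Suc.prems by auto
qed

end

lemma connected_polyline:
  fixes P :: "int \<Rightarrow> 'a::real_normed_vector"
  assumes "a < b"
  shows "connected (\<Union>k\<in>{a..<b}. closed_segment (P k) (P (k + 1)))"
proof -
  have "a + 1 \<le> b" using assms by simp
  then show ?thesis
  proof (induction b rule: int_ge_induct)
    case base
    have "{a..<a + 1} = {a}" by auto
    then show ?case by simp
  next
    case (step b)
    have "{a..<b + 1} = insert b {a..<b}" using step by auto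
    moreover have "P b \<in> closed_segment (P b) (P (b + 1)) \<inter> (\<Union>k\<in>{a..<b}. closed_segment (P k) (P (k + 1)))"
      using step by (auto intro!: bexI[of _ "b - 1"])
    ultimately show ?case using step.IH
      by (simp only: UN_insert) (rule connected_Un, auto)
  qed
qed

text \<open>\<open>t\<close> locates \<open>U\<close> on the edge from \<open>V\<close> to
  \<open>f V\<close>, and \<open>s\<close> locates \<open>Y\<close> on the last edge. As the
  preimage of \<open>U\<close> is \<open>(0, U $ 1 - 1)\<close>, \<open>Y_above\<close> compares
  heights on the switching line. The condition that \<open>Z\<close> is above the line through this
  preimage and \<open>V\<close> is stated after applying \<open>fL\<close>, which maps that line to
  the line through \<open>V\<close> and \<open>f V\<close>.\<close>

locale bcnf_polygon = bcnf_orbit +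
  fixes t s :: real and U Y :: "real^2"
  assumes U: "U = (1 - t) *\<^sub>R V + t *\<^sub>R P (1 - int n)" and t: "0 \<le> t" "t < 1" and U_2: "U $ 2 = 0"
    and Y: "Y = (1 - s) *\<^sub>R P (int r - 1) + s *\<^sub>R Z" and s: "0 < s" "s \<le> 1" and Y_1: "Y $ 1 = 0"
    and Y_above: "U $ 1 - 1 < Y $ 2"
    and side_Z: "0 < side Z" and side_fL_Z: "0 < side (fL Z)"
begin

definition C :: "(real^2) set" where
  "C = closed_segment U (P (1 - int n))
       \<union> (\<Union>k\<in>{1 - int n..<int r}. closed_segment (P k) (P (k + 1))) \<union> closed_segment Z U"

lemma compact_C: "compact C"
  unfolding C_def by (intro compact_Un compact_UN) auto

lemma edge_subset_C: "- int n < k \<Longrightarrow> k < int r \<Longrightarrow> closed_segment (P k) (P (k + 1)) \<subseteq> C"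
  unfolding C_def by (force simp: Bex_def)

lemma C_cases:
  assumes "x \<in> C"
  obtains "x \<in> closed_segment U (P (1 - int n))"
  | k where "- int n < k" "k \<le> 0" "x \<in> closed_segment (P k) (P (k + 1))"
  | k where "1 \<le> k" "k < int r" "x \<in> closed_segment (P k) (P (k + 1))"
  | "x \<in> closed_segment Z U"
proof -
  consider "x \<in> closed_segment U (P (1 - int n))" | "x \<in> closed_segment Z U"
    | k where "- int n < k" "k < int r" "x \<in> closed_segment (P k) (P (k + 1))"
    using assms unfolding C_def by force
  then show thesis
  proof cases
    case (3 k)
    then show ?thesis using that(2)[of k] that(3)[of k] by (cases "k \<le> 0") simp_all
  qed (use that in auto)
qed

lemma U_1: "U $ 1 < 0"
  using P_left[of "- int n"] P_nonpos[of "1 - int n"] t n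
  by (auto simp: U intro!: add_neg_nonpos mult_nonneg_nonpos mult_pos_neg)

lemma side_U [simp]: "side U = 0"
  by (simp add: U side_convex_combination)

lemma side_fL_U: "side (fL U) = t * turn \<tau>\<^sub>L \<delta>\<^sub>L D"
  by (simp add: U affine_piece_convex_combination side_convex_combination fL_V side_fL_fV)

lemma side_fL_U_nonneg: "0 \<le> side (fL U)"
  using side_fL_U turn_left t by simp

abbreviation F :: "real^2" where "F \<equiv> vector [0, U $ 1 - 1]"

lemma fL_F [simp]: "fL F = U"
  by (rule vec2_eqI) (auto simp: U_2)

lemma fL_V_eq: "P (1 - int n) $ 1 = \<tau>\<^sub>L * V $ 1 + V $ 2 + 1" "P (1 - int n) $ 2 = - \<delta>\<^sub>L * V $ 1"
  unfolding fL_V[symmetric] by simp_all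

text \<open>The linear part of \<open>fL\<close> maps \<open>F - V\<close> to
  \<open>U - f V\<close>, that is, to \<open>(t - 1) D\<close>. Comparing determinants gives
  \<open>\<delta>\<^sub>L * side F = (1 - t) * turn \<tau>\<^sub>L \<delta>\<^sub>L
  D\<close>.\<close>

lemma side_F: "0 < side F"
proof -
  have t': "V $ 2 = - t * D $ 2" using U_2 unfolding U by (simp add: algebra_simps)
  have u': "U $ 1 = V $ 1 + t * D $ 1" unfolding U by (simp add: algebra_simps)
  have d1: "D $ 1 = \<tau>\<^sub>L * V $ 1 + V $ 2 + 1 - V $ 1" and d2: "D $ 2 = - \<delta>\<^sub>L * V $ 1 - V $ 2"
    using fL_V_eq by auto
  define a b v w where "a = D $ 1" and "b = D $ 2" and "v = V $ 1" and "w = V $ 2"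
  have 1: "w = - t * b" "a = \<tau>\<^sub>L * v + w + 1 - v" "b = - \<delta>\<^sub>L * v - w"
    using t' d1 d2 by (auto simp: a_def b_def v_def w_def)
  have "\<delta>\<^sub>L * side F = \<delta>\<^sub>L * (- v * b - (v + t * a - 1 - w) * a)"
    unfolding side_def vector_2 u' a_def b_def v_def w_def by simp
  also have "\<dots> = (1 - t) * (b\<^sup>2 + \<tau>\<^sub>L * a * b + \<delta>\<^sub>L * a\<^sup>2)"
    using 1 by algebra
  also have "\<dots> = (1 - t) * turn \<tau>\<^sub>L \<delta>\<^sub>L D" by (simp only: turn_def a_def b_def)
  finally have "\<delta>\<^sub>L * side F = (1 - t) * turn \<tau>\<^sub>L \<delta>\<^sub>L D" .
  moreover have "0 < (1 - t) * turn \<tau>\<^sub>L \<delta>\<^sub>L D" using turn_left t by simp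
  ultimately show ?thesis using \<delta>\<^sub>L by (metis zero_less_mult_pos)
qed

lemma side_0: "0 < side 0"
proof -
  have "side 0 = side U - U $ 1 * D $ 2" using U_2 by (simp only: side_def zero_index) (simp add: algebra_simps)
  then show ?thesis using U_1 D_2 by (simp add: mult_neg_pos)
qed

lemma P_last: "0 < P (int r - 1) $ 1" "P (int r - 1) $ 2 \<le> 0"
proof -
  show "0 < P (int r - 1) $ 1" using P_right[of "int r - 1"] r by simp
  show "P (int r - 1) $ 2 \<le> 0"
    using P_lower[of "int r - 1"] r by (cases "r = 2") auto
qed

lemma fR_P_last: "fR (P (int r - 1)) = Z"
  using fR_P[of "int r - 1"] r by simp

lemma Y_2: "Y $ 2 < 0"
  unfolding Y using P_last(2) Z_2 s by (simp add: add_nonpos_neg mult_nonneg_nonpos mult_pos_neg)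

text \<open>\<open>Y\<close> is strictly between the origin and \<open>F\<close> on the switching
  line, and \<open>side\<close> is positive at both.\<close>

lemma side_Y: "0 < side Y"
proof -
  define u where "u = Y $ 2 / (U $ 1 - 1)"
  have u: "0 < u" "u < 1" using Y_2 Y_above U_1 by (auto simp: u_def divide_simps)
  have "Y = (1 - u) *\<^sub>R 0 + u *\<^sub>R F"
    using Y_1 U_1 by (intro vec2_eqI) (auto simp: u_def)
  then have "side Y = (1 - u) * side 0 + u * side F" by (simp only: side_convex_combination)
  then show ?thesis using u side_0 side_F by (simp add: add_pos_pos)
qed

lemma side_fL_eq:
  "side (fL x) = (\<tau>\<^sub>L * D $ 2 + \<delta>\<^sub>L * D $ 1) * x $ 1 + D $ 2 * x $ 2 + ((1 - V $ 1) * D $ 2 + V $ 2 * D $ 1)"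
  by (simp only: side_def affine_piece_nth) (simp add: algebra_simps)

lemma side_fL_Sigma: "x $ 1 = 0 \<Longrightarrow> side (fL x) = D $ 2 * (x $ 2 - (U $ 1 - 1))"
proof -
  assume x: "x $ 1 = 0"
  have "side (fL x) - side (fL F) = D $ 2 * (x $ 2 - (U $ 1 - 1))"
    using x by (simp only: side_fL_eq vector_2) (simp add: algebra_simps)
  then show ?thesis by simp
qed

lemma side_fL_Y: "0 < side (fL Y)"
  using side_fL_Sigma[OF Y_1] D_2 Y_above by simp

lemma last_edge_nth_1:
  "((1 - w) *\<^sub>R P (int r - 1) + w *\<^sub>R Z) $ 1 = (s - w) * (P (int r - 1) $ 1 - Z $ 1)"
proof -
  have "(1 - s) * P (int r - 1) $ 1 + s * Z $ 1 = 0" using Y_1 unfolding Y by simp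
  then show ?thesis by (simp add: algebra_simps)
qed

lemma last_edge_cases:
  assumes "x \<in> closed_segment (P (int r - 1)) Z"
  shows "x $ 1 \<le> 0 \<Longrightarrow> x \<in> closed_segment Y Z" "0 \<le> x $ 1 \<Longrightarrow> x \<in> closed_segment (P (int r - 1)) Y"
proof -
  obtain w where w: "0 \<le> w" "w \<le> 1" "x = (1 - w) *\<^sub>R P (int r - 1) + w *\<^sub>R Z"
    using assms by (rule closed_segmentE)
  have pos: "0 < P (int r - 1) $ 1 - Z $ 1" using P_last P_r_1 by simp
  show "x \<in> closed_segment Y Z" if "x $ 1 \<le> 0"
  proof (cases "s = 1")
    case True
    then have "w = 1" using that w pos last_edge_nth_1[of w] by (simp add: mult_le_0_iff)
    then show ?thesis using w by simp
  next
    case False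
    have "s \<le> w" using that w pos last_edge_nth_1[of w] by (simp add: mult_le_0_iff)
    define u where "u = (w - s) / (1 - s)"
    have "0 \<le> u" "u \<le> 1" using \<open>s \<le> w\<close> w s False by (auto simp: u_def)
    moreover have "x = (1 - u) *\<^sub>R Y + u *\<^sub>R Z"
    proof -
      have "(1 - u) * (1 - s) = 1 - w" using False s by (simp add: u_def field_simps)
      moreover from this have "(1 - u) * s + u = w" by (simp add: algebra_simps)
      ultimately show ?thesis
        unfolding Y w(3) by (simp add: scaleR_add_right flip: scaleR_add_left)
    qed
    ultimately show ?thesis by (auto simp: closed_segment_def)
  qed
  show "x \<in> closed_segment (P (int r - 1)) Y" if "0 \<le> x $ 1"
  proof -
    have "w \<le> s" using that w pos last_edge_nth_1[of w] by (simp add: zero_le_mult_iff)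
    define u where "u = w / s"
    have "0 \<le> u" "u \<le> 1" using \<open>w \<le> s\<close> w s by (auto simp: u_def)
    moreover have "x = (1 - u) *\<^sub>R P (int r - 1) + u *\<^sub>R Y"
    proof -
      have "u * s = w" using s by (simp add: u_def)
      moreover from this have "(1 - u) + u * (1 - s) = 1 - w" by (simp add: algebra_simps)
      ultimately show ?thesis
        unfolding Y w(3) by (simp add: scaleR_add_right flip: scaleR_add_left add.assoc)
    qed
    ultimately show ?thesis by (auto simp: closed_segment_def)
  qed
qed

lemma segment_Y_Z:
  assumes "x \<in> closed_segment Y Z"
  shows "x $ 1 \<le> 0" "x $ 2 < 0" "0 < side x" "0 < side (fL x)" "x $ 1 = 0 \<Longrightarrow> x = Y"
proof -
  obtain u where u: "0 \<le> u" "u \<le> 1" "x = (1 - u) *\<^sub>R Y + u *\<^sub>R Z"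
    using assms by (rule closed_segmentE)
  have pos: "0 < (1 - u) * a + u * b" if "0 < a" "0 < b" for a b
    using u that by (cases "u = 0") (auto intro!: add_nonneg_pos)
  show "x $ 1 \<le> 0" using u P_r_1 Y_1 by (simp add: mult_nonneg_nonpos)
  have "0 < (1 - u) * (- Y $ 2) + u * (- Z $ 2)" using Y_2 Z_2 by (intro pos) auto
  also have "\<dots> = - x $ 2" using u(3) by simp
  finally show "x $ 2 < 0" by simp
  show "0 < side x" using pos side_Y side_Z u by (simp add: side_convex_combination)
  show "0 < side (fL x)" using pos side_fL_Y side_fL_Z u
    by (simp only: side_convex_combination affine_piece_convex_combination)
  assume "x $ 1 = 0"
  then have "u * Z $ 1 = 0" using u Y_1 by simp
  then consider "u = 0" | "Z $ 1 = 0" by auto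
  then show "x = Y"
  proof cases
    case 2
    then have "s = 1" using Y_1 P_last s unfolding Y by auto
    then show ?thesis using u Y by (simp flip: scaleR_add_left)
  qed (use u in simp)
qed

text \<open>The strict bounds must exclude \<open>U\<close>: \<open>side U\<close> is 0, and
  \<open>side (fL U)\<close> is 0 when \<open>t = 0\<close>.\<close>

lemma segment_Z_U:
  assumes "x \<in> closed_segment Z U"
  shows "x $ 1 \<le> 0" "x $ 2 < 0 \<or> x = U" "x \<noteq> U \<Longrightarrow> 0 < side x" "x \<noteq> U \<Longrightarrow> 0 < side (fL x)"
    "x $ 1 = 0 \<Longrightarrow> x = Z"
proof -
  obtain u where u: "0 \<le> u" "u \<le> 1" "x = (1 - u) *\<^sub>R Z + u *\<^sub>R U"
    using assms by (rule closed_segmentE)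
  show "x $ 1 \<le> 0" using u P_r_1 U_1 by (simp add: mult_nonneg_nonpos add_nonpos_nonpos)
  show "x $ 2 < 0 \<or> x = U"
    using segment_nth_2_neg[of x U Z] assms U_2 Z_2 by (simp add: closed_segment_commute)
  show "0 < side x" if "x \<noteq> U"
  proof -
    have "u < 1" using that u by (cases "u = 1") auto
    then show ?thesis using u side_Z by (simp add: side_convex_combination)
  qed
  show "0 < side (fL x)" if "x \<noteq> U"
  proof -
    have "u < 1" using that u by (cases "u = 1") auto
    then show ?thesis using u side_fL_Z side_fL_U_nonneg
      by (simp add: side_convex_combination affine_piece_convex_combination add_pos_nonneg)
  qed
  show "x = Z" if "x $ 1 = 0"
  proof -
    have "(1 - u) * Z $ 1 \<le> 0" using u P_r_1 by (simp add: mult_nonneg_nonpos)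
    moreover have "u * U $ 1 \<le> 0" using u U_1 by (simp add: mult_nonneg_nonpos)
    moreover have "(1 - u) * Z $ 1 + u * U $ 1 = 0" using that u(3) by simp
    ultimately have "u * U $ 1 = 0" by linarith
    then show ?thesis using u U_1 by simp
  qed
qed

lemma segment_U:
  assumes "x \<in> closed_segment U (P (1 - int n))"
  shows "x $ 1 \<le> 0" "0 < x $ 2 \<or> x = U" "side x = 0" "x \<in> closed_segment V (P (1 - int n))"
proof -
  obtain u where u: "0 \<le> u" "u \<le> 1" "x = (1 - u) *\<^sub>R U + u *\<^sub>R P (1 - int n)"
    using assms by (rule closed_segmentE)
  show "x $ 1 \<le> 0" using u P_nonpos[of "1 - int n"] U_1 n
    by (simp add: mult_nonneg_nonpos add_nonpos_nonpos)
  show "0 < x $ 2 \<or> x = U"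
    using segment_nth_2_pos[OF assms] U_2 P_upper[of "1 - int n"] n by simp
  show "side x = 0" using u by (simp add: side_convex_combination)
  have "U \<in> closed_segment V (P (1 - int n))"
    using U t by (auto simp: closed_segment_def)
  then show "x \<in> closed_segment V (P (1 - int n))"
    using assms by (meson ends_in_segment(2) subsetD subset_closed_segment)
qed

section \<open>The chain above, below and on the horizontal axis\<close>

lemma C_upper:
  assumes "x \<in> C" "0 < x $ 2"
  obtains "x \<in> closed_segment U (P (1 - int n))"
  | k where "- int n < k" "k \<le> 0" "x \<in> closed_segment (P k) (P (k + 1))"
  using assms(1)
proof (cases rule: C_cases)
  case (3 k)
  then show ?thesis using edge_lower_2[of x k] assms by auto
next
  case 4
  then show ?thesis using segment_Z_U(2)[of x] assms U_2 by auto
qed (use that in auto)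

lemma C_lower:
  assumes "x \<in> C" "x $ 2 < 0"
  obtains k where "1 \<le> k" "k < int r" "x \<in> closed_segment (P k) (P (k + 1))"
  | "x \<in> closed_segment Z U"
  using assms(1)
proof (cases rule: C_cases)
  case 1
  then show ?thesis using segment_U(2)[of x] assms U_2 by auto
next
  case (2 k)
  then show ?thesis using edge_upper_2[of x k] assms by auto
qed (use that in auto)

lemma C_axis: "x \<in> C \<Longrightarrow> x $ 2 = 0 \<Longrightarrow> x = U \<or> x = P 1"
  by (cases x rule: C_cases) (use edge_upper_2 edge_lower_2 segment_U(2) segment_Z_U(2) in fastforce)+

lemma U_in_C: "U \<in> C" and Z_in_C: "Z \<in> C" and P_1_in_C: "P 1 \<in> C"
proof -
  show "U \<in> C" "Z \<in> C" by (auto simp: C_def)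
  show "P 1 \<in> C" using edge_subset_C[of 1] r by auto
qed

subsection \<open>Forward invariance\<close>

lemma fY: "f Y = fL Y" "f Y = fR Y"
  using Y_1 f_left[of Y] f_right[of Y] by simp_all

lemma fL_Y_nth: "fL Y $ 1 = Y $ 2 + 1" "fL Y $ 2 = 0"
  using Y_1 by auto

text \<open>The horizontal axis cuts \<open>C\<close> at \<open>U\<close> and \<open>P 1\<close>
  into two connected polylines, so \<open>axis_segment_filled\<close> applies to the segment between
  these points, and \<open>fL Y\<close> is strictly between them.\<close>

lemma fL_Y_inside: "fL Y \<in> inside C"
proof -
  have "C \<inter> {x. 0 \<le> x $ 2} =
      closed_segment U (P (1 - int n)) \<union> (\<Union>k\<in>{1 - int n..<1}. closed_segment (P k) (P (k + 1)))"
    (is "_ = ?A")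
  proof (intro subset_antisym subsetI)
    fix x assume x: "x \<in> C \<inter> {x. 0 \<le> x $ 2}"
    show "x \<in> ?A"
    proof (cases "x $ 2 = 0")
      case True
      then have "x = U \<or> x = P 1" using x C_axis by auto
      moreover have "P 1 \<in> closed_segment (P 0) (P (0 + 1))" by simp
      ultimately show ?thesis using n by (auto intro!: bexI[of _ 0])
    next
      case False
      then have "0 < x $ 2" using x by simp
      from IntD1[OF x] this show ?thesis by (cases rule: C_upper) force+
    qed
  next
    fix x assume "x \<in> ?A"
    then consider "x \<in> closed_segment U (P (1 - int n))"
      | k where "k \<in> {1 - int n..<1}" "x \<in> closed_segment (P k) (P (k + 1))" by blast
    then show "x \<in> C \<inter> {x. 0 \<le> x $ 2}"
    proof cases
      case 1
      then show ?thesis using segment_U(2)[of x] U_2 by (auto simp: C_def)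
    next
      case (2 k)
      then show ?thesis using edge_upper_2[of x k] edge_subset_C[of k] r by auto
    qed
  qed
  moreover have "connected ?A"
  proof (intro connected_Un connected_segment connected_polyline)
    have "P (1 - int n) \<in> closed_segment U (P (1 - int n)) \<inter>
        (\<Union>k\<in>{1 - int n..<1}. closed_segment (P k) (P (k + 1)))"
      using n by (auto intro!: bexI[of _ "1 - int n"])
    then show "closed_segment U (P (1 - int n)) \<inter>
        (\<Union>k\<in>{1 - int n..<1}. closed_segment (P k) (P (k + 1))) \<noteq> {}" by blast
  qed (use n in auto)
  ultimately have up: "connected (C \<inter> {x. 0 \<le> x $ 2})" by simp
  have "C \<inter> {x. x $ 2 \<le> 0} =
      (\<Union>k\<in>{1..<int r}. closed_segment (P k) (P (k + 1))) \<union> closed_segment Z U"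
    (is "_ = ?B")
  proof (intro subset_antisym subsetI)
    fix x assume x: "x \<in> C \<inter> {x. x $ 2 \<le> 0}"
    show "x \<in> ?B"
    proof (cases "x $ 2 = 0")
      case True
      then have "x = U \<or> x = P 1" using x C_axis by auto
      moreover have "P 1 \<in> closed_segment (P 1) (P (1 + 1))" by simp
      ultimately show ?thesis using r by (auto intro!: bexI[of _ 1])
    next
      case False
      then have "x $ 2 < 0" using x by simp
      from IntD1[OF x] this show ?thesis by (cases rule: C_lower) force+
    qed
  next
    fix x assume "x \<in> ?B"
    then consider "x \<in> closed_segment Z U"
      | k where "1 \<le> k" "k < int r" "x \<in> closed_segment (P k) (P (k + 1))" by force
    then show "x \<in> C \<inter> {x. x $ 2 \<le> 0}"
    proof cases
      case 1
      then show ?thesis using segment_Z_U(2)[of x] U_2 by (auto simp: C_def)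
    next
      case (2 k)
      then show ?thesis using edge_lower_2[of x k] edge_subset_C[of k] by auto
    qed
  qed
  moreover have "connected ?B"
  proof (intro connected_Un connected_segment connected_polyline)
    have "Z \<in> (\<Union>k\<in>{1..<int r}. closed_segment (P k) (P (k + 1))) \<inter> closed_segment Z U"
      using r by (auto intro!: bexI[of _ "int r - 1"])
    then show "(\<Union>k\<in>{1..<int r}. closed_segment (P k) (P (k + 1))) \<inter> closed_segment Z U \<noteq> {}"
      by blast
  qed (use r in auto)
  ultimately have low: "connected (C \<inter> {x. x $ 2 \<le> 0})" by simp
  have "fL Y \<in> C \<union> inside C"
    by (rule axis_segment_filled[OF compact_C up low U_in_C U_2 P_1_in_C])
      (use Y_1 Y_above Y_2 \<beta> in simp_all)
  moreover have "fL Y \<notin> C"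
  proof
    assume "fL Y \<in> C"
    then have "fL Y = U \<or> fL Y = P 1" using C_axis fL_Y_nth by blast
    then show False using fL_Y_nth(1) Y_above Y_2 \<beta> P_1_nth(1) by (metis add_less_cancel_right diff_add_cancel
        less_irrefl add_less_same_cancel2 less_trans)
  qed
  ultimately show ?thesis by simp
qed

lemma fL_Y_notin_C: "fL Y \<notin> C"
  using fL_Y_inside inside_no_overlap by blast

text \<open>A common point with a lower edge pulls back to a common point \<open>q\<close> of two
  right edges, one of them the last; by \<open>right_edges_Int\<close> this is
  \<open>P (r - 1)\<close>, excluded by \<open>u > 0\<close>. A common point with the segment from
  \<open>Z\<close> to \<open>U\<close> has equal heights in both parametrizations, which forces
  \<open>fL Y = U\<close>.\<close>

lemma segment_Z_fL_Y_notin_C: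
  assumes u: "0 < u" "u \<le> 1"
  shows "(1 - u) *\<^sub>R Z + u *\<^sub>R fL Y \<notin> C" (is "?x \<notin> C")
proof
  assume x: "?x \<in> C"
  define q where "q = (1 - u) *\<^sub>R P (int r - 1) + u *\<^sub>R Y"
  have fq: "?x = fR q"
    unfolding q_def affine_piece_convex_combination fR_P_last using fY by simp
  show False
  proof (cases "u = 1")
    case True
    then show ?thesis using x fL_Y_notin_C by simp
  next
    case False
    moreover have "?x $ 2 = (1 - u) * Z $ 2"
      using fL_Y_nth(2) by (simp del: affine_piece_nth)
    ultimately have "?x $ 2 < 0" using u Z_2 by (simp only: mult_pos_neg)
    with x show False
    proof (cases rule: C_lower)
      case (1 k)
      have "?x \<in> fR ` closed_segment (P (k - 1)) (P (k - 1 + 1))"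
        using 1 edge_right_image[of "k - 1"] by (simp add: algebra_simps)
      then have "q \<in> closed_segment (P (k - 1)) (P (k - 1 + 1))"
        unfolding fq using \<delta>\<^sub>R by (auto simp: affine_piece_inject)
      moreover have "q \<in> closed_segment (P (int r - 1)) (P (int r - 1 + 1))"
      proof -
        have "Y \<in> closed_segment (P (int r - 1)) Z" using Y s by (auto simp: closed_segment_def)
        moreover have "q \<in> closed_segment (P (int r - 1)) Y"
          using u by (auto simp: q_def closed_segment_def)
        ultimately show ?thesis by (simp, meson ends_in_segment(1) subsetD subset_closed_segment)
      qed
      ultimately have "q = P (int r - 1)"
        using right_edges_Int[of "nat (k - 1)" "int r - 1" q] 1 by simp
      then have "u *\<^sub>R (Y - P (int r - 1)) = 0" by (simp add: q_def algebra_simps)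
      then show False using u Y_1 P_last by auto
    next
      case 2
      then obtain a where a: "?x = (1 - a) *\<^sub>R Z + a *\<^sub>R U" by (rule closed_segmentE)
      then have "?x $ 2 = (1 - a) * Z $ 2" using U_2 by simp
      moreover have "?x $ 2 = (1 - u) * Z $ 2" using fL_Y_nth(2) by (simp del: affine_piece_nth)
      ultimately have "a = u" using Z_2 by simp
      then have "u *\<^sub>R fL Y = u *\<^sub>R U" using a by simp
      then have "fL Y = U" using u by simp
      then show False using fL_Y_notin_C U_in_C by simp
    qed
  qed
qed

text \<open>An upper point of \<open>C\<close> is on the segment from \<open>U\<close> to
  \<open>f V\<close> or on the image of a left edge. In the latter case \<open>q\<close> is on that
  left edge, and only the edge from \<open>V\<close> to \<open>f V\<close> can reach down to the
  axis. So \<open>fL q\<close> misses the upper chain when both sides are positive.\<close>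

lemma upper_pullback:
  assumes "fL q \<in> C" "0 < fL q $ 2" "q $ 2 \<le> 0"
  shows "side q = 0 \<or> side (fL q) = 0"
  using assms(1,2)
proof (cases rule: C_upper)
  case 1
  then show ?thesis using segment_U(3) by blast
next
  case (2 k)
  have "fL q \<in> fL ` closed_segment (P (k - 1)) (P (k - 1 + 1))"
    using 2 edge_left_image[of "k - 1"] by (simp add: algebra_simps)
  then have q: "q \<in> closed_segment (P (k - 1)) (P k)"
    using \<delta>\<^sub>L by (auto simp: affine_piece_inject)
  show ?thesis
  proof (cases "k - 1 = - int n")
    case True
    moreover from this have "k = 1 - int n" by simp
    ultimately have "q \<in> closed_segment V (P (1 - int n))" using q by simp
    then show ?thesis by (auto elim!: closed_segmentE simp: side_convex_combination)
  next
    case False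
    then have "0 < P (k - 1) $ 2" "0 < P k $ 2" using 2 P_upper[of "k - 1"] P_upper[of k] by auto
    then show ?thesis using segment_nth_2_pos[OF q] assms(3) by auto
  qed
qed

lemma fL_segment_Y_Z_notin_C:
  assumes "x \<in> closed_segment Y Z"
  shows "fL x \<notin> C"
proof (cases "x $ 1 = 0")
  case True
  then show ?thesis using segment_Y_Z(5)[OF assms] fL_Y_notin_C by simp
next
  case False
  then have "0 < fL x $ 2" using segment_Y_Z(1)[OF assms] \<delta>\<^sub>L by (simp add: mult_pos_neg)
  then show ?thesis using upper_pullback[of x] segment_Y_Z[OF assms] by force
qed

lemma fL_segment_Z_U_notin_C:
  assumes "x \<in> closed_segment Z U" "x \<noteq> U"
  shows "fL x \<notin> C"
proof (cases "x $ 1 = 0")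
  case True
  then show ?thesis using segment_Z_U(5)[OF assms(1)] fL_segment_Y_Z_notin_C[of Z] by simp
next
  case False
  then have "0 < fL x $ 2" using segment_Z_U(1)[OF assms(1)] \<delta>\<^sub>L by (simp add: mult_pos_neg)
  then show ?thesis using upper_pullback[of x] segment_Z_U[OF assms(1)] assms(2) by force
qed

lemma segment_Z_fL_Y_inside:
  "0 < u \<Longrightarrow> u \<le> 1 \<Longrightarrow> (1 - u) *\<^sub>R Z + u *\<^sub>R fL Y \<in> inside C"
proof -
  assume u: "0 < u" "u \<le> 1"
  let ?S = "(\<lambda>u. (1 - u) *\<^sub>R Z + u *\<^sub>R fL Y) ` {0<..1}"
  have "?S \<subseteq> inside C"
  proof (rule connected_subset_inside[OF _ _ _ fL_Y_inside])
    show "connected ?S" by (intro connected_continuous_image continuous_intros) auto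
    show "?S \<inter> C = {}" using segment_Z_fL_Y_notin_C by auto
    show "fL Y \<in> ?S" by (rule image_eqI[of _ _ 1]) auto
  qed
  then show ?thesis using u by auto
qed

lemma fL_segment_Y_Z_inside: "fL ` closed_segment Y Z \<subseteq> inside C"
proof (rule connected_subset_inside[OF _ _ _ fL_Y_inside])
  show "connected (fL ` closed_segment Y Z)" by (simp add: affine_piece_closed_segment)
qed (use fL_segment_Y_Z_notin_C in auto)

text \<open>\<open>U\<close> is removed because \<open>fL U\<close> lies on \<open>C\<close>. The
  rest of the segment is connected and contains \<open>Z\<close>, whose image is already known to be
  inside.\<close>

lemma fL_segment_Z_U_inside: "fL ` (closed_segment Z U - {U}) \<subseteq> inside C"
proof (rule connected_subset_inside)
  have "closed_segment Z U - {U} = (\<lambda>u. (1 - u) *\<^sub>R Z + u *\<^sub>R U) ` {0..<1}"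
  proof (intro subset_antisym subsetI)
    fix x assume x: "x \<in> closed_segment Z U - {U}"
    then obtain u where "0 \<le> u" "u \<le> 1" "x = (1 - u) *\<^sub>R Z + u *\<^sub>R U" by (blast elim: closed_segmentE)
    then show "x \<in> (\<lambda>u. (1 - u) *\<^sub>R Z + u *\<^sub>R U) ` {0..<1}" using x by (cases "u = 1") auto
  next
    fix x assume "x \<in> (\<lambda>u. (1 - u) *\<^sub>R Z + u *\<^sub>R U) ` {0..<1}"
    then obtain u where u: "u \<in> {0..<1}" "x = (1 - u) *\<^sub>R Z + u *\<^sub>R U" by (rule imageE)
    then have "x $ 2 = (1 - u) * Z $ 2" using U_2 by simp
    also have "\<dots> < 0" using u Z_2 by (simp add: mult_pos_neg)
    finally have "x \<noteq> U" using U_2 by auto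
    then show "x \<in> closed_segment Z U - {U}" using u by (auto simp: closed_segment_def)
  qed
  then have "fL ` (closed_segment Z U - {U}) = (\<lambda>u. (1 - u) *\<^sub>R fL Z + u *\<^sub>R fL U) ` {0..<1}"
    by (simp add: image_image affine_piece_convex_combination)
  then show "connected (fL ` (closed_segment Z U - {U}))"
    by (simp, intro connected_continuous_image continuous_intros) (auto simp: is_interval_connected)
  show "fL ` (closed_segment Z U - {U}) \<inter> C = {}" using fL_segment_Z_U_notin_C by auto
  show "fL Z \<in> fL ` (closed_segment Z U - {U})" using Z_2 U_2 by auto
  show "fL Z \<in> inside C" using fL_segment_Y_Z_inside by auto
qed

text \<open>The segment from \<open>U\<close> to \<open>f V\<close> and the edges before the last
  are mapped into edges. The last edge is cut at \<open>Y\<close>, with the right piece acting on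
  one part and the left piece on the other; these images and that of the segment from
  \<open>Z\<close> to \<open>U\<close> were treated above.\<close>

lemma f_C_subset: "f ` C \<subseteq> C \<union> inside C"
proof
  fix y assume "y \<in> f ` C"
  then obtain x where x: "x \<in> C" "y = f x" by auto
  have V_edge: "fL ` closed_segment V (P (1 - int n)) \<subseteq> C"
    using edge_left_image[of "- int n"] edge_subset_C[of "1 - int n"] n r by (simp add: algebra_simps)
  from x(1) show "y \<in> C \<union> inside C"
  proof (cases rule: C_cases)
    case 1
    then show ?thesis using segment_U[OF 1] x V_edge f_left by auto
  next
    case (2 k)
    show ?thesis
    proof (cases "k = 0")
      case True
      then have "fR x \<in> closed_segment (P 1) (P 2)" "0 \<le> x $ 1"
        using 2 edge_right_image[of 0] edge_right_1[of x 0] r by auto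
      then show ?thesis using edge_subset_C[of 1] r x f_right by auto
    next
      case False
      then have "fL x \<in> closed_segment (P (k + 1)) (P (k + 1 + 1))" "x $ 1 \<le> 0"
        using 2 edge_left_image[of k] edge_left_1[of x k] by (auto simp: algebra_simps)
      then show ?thesis using edge_subset_C[of "k + 1"] 2 r x f_left by auto
    qed
  next
    case (3 k)
    show ?thesis
    proof (cases "k = int r - 1")
      case False
      then have "fR x \<in> closed_segment (P (k + 1)) (P (k + 1 + 1))" "0 \<le> x $ 1"
        using 3 edge_right_image[of k] edge_right_1[of x k] by (auto simp: algebra_simps)
      then show ?thesis using edge_subset_C[of "k + 1"] 3 False x f_right by auto
    next
      case True
      then have e: "x \<in> closed_segment (P (int r - 1)) Z" using 3 by simp
      show ?thesis
      proof (cases "x $ 1 \<le> 0")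
        case True
        then show ?thesis
          using last_edge_cases(1)[OF e] fL_segment_Y_Z_inside x f_left by auto
      next
        case False
        then have "x \<in> closed_segment (P (int r - 1)) Y" using last_edge_cases(2)[OF e] by simp
        then have "fR x \<in> closed_segment Z (fL Y)"
          using affine_piece_closed_segment[of \<tau>\<^sub>R \<delta>\<^sub>R "P (int r - 1)" Y] fR_P_last fY by auto
        then obtain u where "0 \<le> u" "u \<le> 1" "fR x = (1 - u) *\<^sub>R Z + u *\<^sub>R fL Y"
          by (rule closed_segmentE)
        then have "fR x \<in> C \<union> inside C"
          using segment_Z_fL_Y_inside[of u] Z_in_C by (cases "u = 0") auto
        then show ?thesis using x f_right False by simp
      qed
    qed
  next
    case 4
    have "U \<in> closed_segment V (P (1 - int n))" using segment_U(4)[of U] by simp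
    then show ?thesis
      using segment_Z_U(1)[OF 4] x f_left V_edge fL_segment_Z_U_inside 4 by (cases "x = U") auto
  qed
qed

lemma f_invariant: "x \<in> C \<union> inside C \<Longrightarrow> f x \<in> C \<union> inside C"
  using homeomorphism_image_filled[of C f "bcnf_inv \<tau>\<^sub>L \<delta>\<^sub>L \<tau>\<^sub>R \<delta>\<^sub>R"] compact_C f_C_subset
    continuous_on_bcnf continuous_on_bcnf_inv bcnf_inv_bcnf bcnf_bcnf_inv \<delta>\<^sub>L \<delta>\<^sub>R
  by (simp add: image_subset_iff)

subsection \<open>Leaving the left half-plane\<close>

lemma g_V: "g n V = 0" "g (Suc n) V = \<beta> + 1" "g (n - 1) V < 0"
  using g_P[of "- int n" n] g_P[of "- int n" "Suc n"] g_P[of "- int n" "n - 1"]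
    P_left[of "-1"] n by (auto simp: of_nat_diff)

lemma g_fV: "g n (P (1 - int n)) = \<beta> + 1" "g (n - 1) (P (1 - int n)) = 0"
  using g_P[of "1 - int n" n] g_P[of "1 - int n" "n - 1"] n by (auto simp: of_nat_diff)

lemma g_U: "g n U = t * (\<beta> + 1)"
  unfolding U g_convex_combination by (simp add: g_V g_fV)

text \<open>\<open>F\<close> is mapped to \<open>U\<close>, a convex combination of \<open>V\<close>
  and \<open>f V\<close>, where \<open>g (n - 1)\<close> and \<open>g n\<close> are known.\<close>

lemma g_F: "g n F < 0" "0 \<le> g (Suc n) F"
proof -
  have "g n F = g (n - 1) U" using g_Suc[of "n - 1" F] n by simp
  also have "\<dots> = (1 - t) * g (n - 1) V" unfolding U g_convex_combination g_fV by simp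
  also have "\<dots> < 0" using t g_V(3) by (simp add: mult_pos_neg)
  finally show "g n F < 0" .
  show "0 \<le> g (Suc n) F" unfolding g_Suc fL_F g_U using t \<beta> by simp
qed

text \<open>The points of the left half-plane that are above the line through \<open>F = f\<inverse> U\<close> and \<open>V\<close> and have
  not left after \<open>n\<close> steps form a triangle with vertices \<open>V\<close>, \<open>F\<close> and \<open>(0, - c n / e n)\<close>.\<close>

lemma wedge:
  assumes x: "x $ 1 \<le> 0" "0 < side (fL x)" "g n x \<le> 0"
  obtains a h where "0 \<le> a" "a < 1" "U $ 1 - 1 < h" "e n * h + c n \<le> 0"
    "x = (1 - a) *\<^sub>R vector [0, h] + a *\<^sub>R V"
proof -
  have V1: "V $ 1 < 0" using P_left[of "- int n"] n by simp
  have en: "0 < e n" using lucas_pos n by simp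
  define a where "a = x $ 1 / V $ 1"
  have a0: "0 \<le> a" and xa: "x $ 1 = a * V $ 1" using x V1 by (auto simp: a_def divide_nonpos_neg)
  have 1: "e n * (x $ 2 - a * V $ 2) + (1 - a) * c n \<le> 0"
  proof -
    have "g n x - a * g n V \<le> 0" using x g_V by simp
    then show ?thesis unfolding g_eq xa by (simp add: algebra_simps)
  qed
  have 2: "(1 - a) * (U $ 1 - 1) < x $ 2 - a * V $ 2"
  proof -
    have "0 < side (fL x) - (1 - a) * side (fL F) - a * side (fL V)"
      using x by (simp add: fL_V)
    also have "\<dots> = D $ 2 * (x $ 2 - a * V $ 2 - (1 - a) * (U $ 1 - 1))"
      unfolding side_fL_eq xa vector_2 by (simp add: algebra_simps)
    finally show ?thesis using D_2 by (simp add: zero_less_mult_iff)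
  qed
  have 3: "e n * (U $ 1 - 1) + c n < 0" using g_F(1) by (simp add: g_eq)
  have "e n * ((1 - a) * (U $ 1 - 1)) < e n * (x $ 2 - a * V $ 2)" using 2 en by simp
  then have "(1 - a) * (e n * (U $ 1 - 1) + c n) < 0" using 1 by (simp add: algebra_simps)
  then have a1: "a < 1" using 3 by (simp add: mult_less_0_iff)
  \<comment> \<open>\<open>h\<close> is the height at which the line through \<open>V\<close> and
    \<open>x\<close> meets the switching line.\<close>
  define h where "h = (x $ 2 - a * V $ 2) / (1 - a)"
  have h: "(1 - a) * h = x $ 2 - a * V $ 2" using a1 by (simp add: h_def)
  show thesis
  proof (rule that[OF a0 a1])
    have "(1 - a) * (U $ 1 - 1) < (1 - a) * h" using 2 h by simp
    then show "U $ 1 - 1 < h" using a1 by (simp only: mult_less_cancel_left_pos diff_gt_0_iff_gt)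
    have "(1 - a) * (e n * h + c n) \<le> 0" using 1 unfolding h[symmetric] by (simp add: algebra_simps)
    then show "e n * h + c n \<le> 0" using a1 by (simp add: mult_le_0_iff)
    show "x = (1 - a) *\<^sub>R vector [0, h] + a *\<^sub>R V" using xa h by (intro vec2_eqI) auto
  qed
qed

text \<open>By convexity only \<open>(0, h)\<close> and \<open>V\<close> matter. If
  \<open>e (Suc n) > 0\<close>, then \<open>g (Suc n)\<close> increases with height, and
  \<open>(0, h)\<close> is above \<open>F\<close>. Otherwise the Wronskian expresses
  \<open>g (Suc n)\<close> at \<open>(0, h)\<close> through the nonpositive value of
  \<open>g n\<close> there.\<close>

lemma wedge_leaves:
  assumes x: "x $ 1 \<le> 0" "0 < side (fL x)" "g n x \<le> 0"
  shows "0 < g (Suc n) x"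
proof -
  obtain a h where ah: "0 \<le> a" "a < 1" "U $ 1 - 1 < h" "e n * h + c n \<le> 0"
    "x = (1 - a) *\<^sub>R vector [0, h] + a *\<^sub>R V"
    using wedge[OF x] .
  let ?h = "vector [0, h] :: real^2"
  have en: "0 < e n" using lucas_pos n by simp
  have "0 < g (Suc n) ?h"
  proof (cases "0 < e (Suc n)")
    case True
    have "g (Suc n) ?h = g (Suc n) F + e (Suc n) * (h - (U $ 1 - 1))"
      by (simp only: g_eq vector_2) (simp add: algebra_simps)
    moreover have "0 < e (Suc n) * (h - (U $ 1 - 1))" using True ah(3) by simp
    ultimately show ?thesis using g_F(2) by linarith
  next
    case False
    have "0 < lucas_wronskian \<tau>\<^sub>L \<delta>\<^sub>L n + e (Suc n) * (e n * h + c n)"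
      using lucas_wronskian_pos[of n] n False ah(4) by (simp add: add_pos_nonneg mult_nonpos_nonpos)
    also have "\<dots> = e n * g (Suc n) ?h"
      by (simp only: g_eq vector_2 lucas_wronskian_def) (simp add: algebra_simps del: lucas_sum_simps)
    finally show ?thesis using en by (simp add: zero_less_mult_iff)
  qed
  moreover have "0 < g (Suc n) V" using g_V \<beta> by simp
  ultimately show ?thesis unfolding ah(5) g_convex_combination
    using ah by (simp add: add_pos_nonneg)
qed

text \<open>If \<open>x\<close> stayed on the left for \<open>Suc n\<close> steps,
  \<open>wedge_leaves\<close> would give \<open>side (fL x) \<le> 0\<close>. Moving \<open>x\<close>
  straight down preserves this and \<open>g k \<le> 0\<close> for \<open>k \<le> n\<close>, and
  together these keep the ray off every part of \<open>C\<close>.\<close>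

lemma leaves_left:
  assumes x: "x \<in> C \<union> inside C" "x $ 1 \<le> 0"
  shows "\<exists>k. 1 \<le> k \<and> k \<le> Suc n \<and> 0 < g k x"
proof (rule ccontr)
  assume "\<not> ?thesis"
  then have gx: "g k x \<le> 0" if "1 \<le> k" "k \<le> Suc n" for k using that by (meson not_le)
  have sx: "side (fL x) \<le> 0"
    using wedge_leaves[OF x(2)] gx[of n] gx[of "Suc n"] n by force
  have "x \<in> outside C"
  proof (rule ray_avoids_imp_outside[OF compact_imp_bounded[OF compact_C]])
    show "- axis 2 1 \<noteq> (0 :: real^2)" by (simp add: axis_eq_0_iff)
    fix u :: real assume u: "0 \<le> u"
    define y where "y = x + u *\<^sub>R (- axis 2 1)"
    have y: "y $ 1 = x $ 1" "y $ 2 = x $ 2 - u" by (auto simp: y_def axis_def)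
    \<comment> \<open>Only \<open>k \<le> n\<close> is possible here, as the sign of
      \<open>e (Suc n)\<close> is not known; the bound at \<open>Suc n\<close> is used at
      \<open>x\<close> itself.\<close>
    have gy: "g k y \<le> 0" if "1 \<le> k" "k \<le> n" for k
    proof -
      have "g k y = g k x - e k * u" by (simp add: g_eq y algebra_simps)
      moreover have "0 \<le> e k * u" using lucas_nonneg that u by simp
      ultimately show ?thesis using gx[of k] that by simp
    qed
    have gy0: "g k y \<le> 0" if "k \<le> n" for k
      using gy[of k] that x(2) y by (cases "k = 0") auto
    have sy: "side (fL y) = side (fL x) - D $ 2 * u"
      unfolding side_fL_eq y by (simp add: algebra_simps)
    moreover have "0 \<le> D $ 2 * u" using D_2 u by simp
    ultimately have sy0: "side (fL y) \<le> 0" using sx by linarith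
    have edge_U: False if "y \<in> closed_segment U (P (1 - int n))"
    proof -
      have "y \<in> closed_segment V (P (1 - int n))" using segment_U(4) that by blast
      then obtain w where w: "0 \<le> w" "w \<le> 1" "y = (1 - w) *\<^sub>R V + w *\<^sub>R P (1 - int n)"
        by (rule closed_segmentE)
      then have "g n y = w * (\<beta> + 1)" by (simp add: g_convex_combination g_V g_fV)
      then have "w = 0" using gy[of n] n w \<beta> by (simp add: mult_le_0_iff)
      then have "y = V" using w by simp
      then have "side (fL y) = 0" by (simp add: fL_V)
      then have "D $ 2 * u \<le> 0" using sy sx by simp
      then have "u = 0" using D_2 u by (simp add: mult_le_0_iff)
      then have "x = V" using \<open>y = V\<close> by (simp add: y_def)
      then show False using gx[of "Suc n"] g_V \<beta> by simp
    qed
    show "x + u *\<^sub>R (- axis 2 1) \<notin> C"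
    proof
      assume "x + u *\<^sub>R (- axis 2 1) \<in> C"
      then have "y \<in> C" by (simp add: y_def)
      then show False
      proof (cases rule: C_cases)
        case 1
        then show False by (rule edge_U)
      next
        case (2 k)
        \<comment> \<open>Along this edge \<open>g j\<close> goes from 0 to
          \<open>\<beta> + 1\<close>, so only the endpoint \<open>P k\<close> is left, and that
          point is on the right one step later.\<close>
        define j where "j = nat (- k)"
        have j: "k = - int j" "j < n" using 2 by (auto simp: j_def)
        obtain w where w: "0 \<le> w" "w \<le> 1" "y = (1 - w) *\<^sub>R P k + w *\<^sub>R P (k + 1)"
          using 2(3) by (rule closed_segmentE)
        have gk: "g j (P k) = 0" "g (Suc j) (P k) = \<beta> + 1"
          using g_P[of k j] g_P[of k "Suc j"] j by auto
        have "g j (P (k + 1)) = \<beta> + 1"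
        proof (cases "j = 0")
          case False
          then show ?thesis using g_P[of "k + 1" j] j by simp
        qed (use j in simp)
        then have "g j y = w * (\<beta> + 1)" using w gk by (simp add: g_convex_combination)
        then have "w = 0" using gy0[of j] j w \<beta> by (simp add: mult_le_0_iff)
        then have "y = P k" using w by simp
        then show False using gy[of "Suc j"] gk j \<beta> by simp
      next
        case (3 k)
        show False
        proof (cases "k = int r - 1")
          case True
          then have "y \<in> closed_segment Y Z" using last_edge_cases(1)[of y] 3 x y by simp
          then show False using segment_Y_Z(4) sy0 by force
        next
          case False
          then have "0 < P k $ 1" "0 < P (k + 1) $ 1" using 3 P_right by auto
          moreover obtain w where "0 \<le> w" "w \<le> 1" "y = (1 - w) *\<^sub>R P k + w *\<^sub>R P (k + 1)"
            using 3(3) by (rule closed_segmentE)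
          ultimately have "0 < y $ 1" by (cases "w = 0") (auto intro!: add_nonneg_pos)
          then show False using x y by simp
        qed
      next
        case 4
        then have "y = U" using segment_Z_U(4) sy0 by force
        then show False using edge_U by simp
      qed
    qed
  qed
  then show False using x union_with_inside by blast
qed

text \<open>\<open>fL Y\<close> is above the line through \<open>Y\<close> and \<open>Z\<close>, because the right chain turns clockwise.\<close>

lemma fL_Y_above: "0 \<le> fL Y $ 1 * Z $ 2 + (Z $ 1 - fL Y $ 1) * Y $ 2"
proof -
  define a b where "a = P (int r - 1) $ 1" and "b = P (int r - 1) $ 2"
  have Z: "Z $ 1 = \<tau>\<^sub>R * a + b + 1" "Z $ 2 = - \<delta>\<^sub>R * a"
    using affine_piece_nth[of \<tau>\<^sub>R \<delta>\<^sub>R "P (int r - 1)"] by (simp_all only: fR_P_last a_def b_def)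
  have Y1: "(1 - s) * a + s * Z $ 1 = 0" using Y_1 unfolding Y by (simp add: a_def)
  have Y2: "Y $ 2 = (1 - s) * b + s * Z $ 2" unfolding Y by (simp add: b_def)
  have "fL Y $ 1 * Z $ 2 + (Z $ 1 - fL Y $ 1) * Y $ 2
      = s * (1 - s) * ((Z $ 2 - b)\<^sup>2 + \<tau>\<^sub>R * (Z $ 1 - a) * (Z $ 2 - b) + \<delta>\<^sub>R * (Z $ 1 - a)\<^sup>2)"
    unfolding fL_Y_nth using Y1 Y2 Z by algebra
  also have "\<dots> = s * (1 - s) * turn \<tau>\<^sub>R \<delta>\<^sub>R (Z - P (int r - 1))"
    by (simp add: turn_def a_def b_def)
  finally show ?thesis using s turn_right by simp
qed

text \<open>The quadrant argument stops at \<open>n - 1\<close>. For the last step, if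
  \<open>Z\<close> were not on the right after \<open>n\<close> steps, it would lie in the triangle
  of \<open>wedge\<close>, and \<open>g (n - 1)\<close> is nonpositive at both \<open>(0, h)\<close>
  and \<open>V\<close>.\<close>

lemma g_Z_mono:
  assumes "1 \<le> j" "j \<le> k" "k \<le> n" "0 < g j Z"
  shows "0 < g k Z"
proof (cases "k < n \<or> j = k")
  case True
  then show ?thesis using assms g_quadrant_mono[of j k Z] P_r_1 Z_2 by auto
next
  case False
  then have k: "k = n" and jn: "j \<le> n - 1" "1 \<le> n - 1" using assms by auto
  have pos: "0 < g (n - 1) Z"
    using g_quadrant_mono[of j "n - 1" Z] assms jn n P_r_1 Z_2 by simp
  show ?thesis
  proof (rule ccontr)
    assume "\<not> 0 < g k Z"
    then have "g n Z \<le> 0" using k by simp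
    obtain a h where ah: "0 \<le> a" "a < 1" "U $ 1 - 1 < h" "e n * h + c n \<le> 0"
      "Z = (1 - a) *\<^sub>R vector [0, h] + a *\<^sub>R V"
      using wedge[OF P_r_1 side_fL_Z \<open>g n Z \<le> 0\<close>] .
    let ?h = "vector [0, h] :: real^2"
    define m where "m = n - 1"
    have m: "n = Suc m" "1 \<le> m" using jn n by (auto simp: m_def)
    have "e n * g m ?h = e m * (e n * h + c n) - lucas_wronskian \<tau>\<^sub>L \<delta>\<^sub>L m"
      unfolding m(1) by (simp only: g_eq vector_2 lucas_wronskian_def)
        (simp add: algebra_simps del: lucas_sum_simps lucas.simps)
    also have "\<dots> \<le> 0"
      using mult_nonneg_nonpos[OF lucas_nonneg[of m] ah(4)] lucas_wronskian_nonneg[of m] m by linarith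
    finally have "g m ?h \<le> 0" using lucas_pos[of n] n by (simp add: mult_le_0_iff)
    moreover have "g m V \<le> 0" using g_V m by simp
    ultimately have "g m Z \<le> 0" unfolding ah(5) g_convex_combination
      using ah by (simp add: add_nonpos_nonpos mult_nonneg_nonpos)
    then show False using pos m_def by simp
  qed
qed

text \<open>If \<open>fL Y\<close> is not on the right, \<open>g k\<close> is positive at both ends
  of the segment: at \<open>fL Y\<close> it equals \<open>g (Suc k) Y\<close>, and for
  \<open>k = n\<close> the point is between \<open>U\<close> and the origin. If \<open>fL Y\<close>
  is on the right, then by \<open>fL_Y_above\<close> the left part of the segment is not below the
  segment from \<open>Y\<close> to \<open>Z\<close>, and \<open>g k\<close> increases
  upwards.\<close>

lemma g_image_last_edge:
  assumes k: "1 \<le> k" "k \<le> n" and gY: "1 \<le> i" "i \<le> k" "0 < g i Y" and gZ: "0 < g k Z"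
    and x: "x \<in> closed_segment Z (fL Y)" "x $ 1 \<le> 0"
  shows "0 < g k x"
proof -
  have gkY: "0 < g k Y" using g_Sigma_mono[of i k Y] k gY Y_1 by simp
  have ek: "0 < e k" using lucas_pos k by simp
  obtain u where u: "0 \<le> u" "u \<le> 1" "x = (1 - u) *\<^sub>R Z + u *\<^sub>R fL Y"
    using x(1) by (rule closed_segmentE)
  define p where "p = fL Y $ 1"
  show ?thesis
  proof (cases "p \<le> 0")
    case True
    have "0 < g k (fL Y)"
    proof (cases "k < n")
      case True
      then show ?thesis using g_Sigma_mono[of i "Suc k" Y] gY Y_1 by (simp add: g_Suc)
    next
      case False
      then have kn: "k = n" using k by simp
      define w where "w = p / U $ 1"
      have w: "0 \<le> w" "w < 1"
        using True U_1 fL_Y_nth(1) Y_above by (auto simp: w_def p_def divide_nonpos_neg field_simps)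
      have "fL Y = (1 - w) *\<^sub>R 0 + w *\<^sub>R U"
        using fL_Y_nth(2) U_2 U_1 by (intro vec2_eqI) (auto simp: w_def p_def)
      then have "g n (fL Y) = (1 - w) * g n 0 + w * g n U" by (simp only: g_convex_combination)
      moreover have "0 < g n 0" using lucas_sum_pos[of n] n by (simp add: g_eq)
      moreover have "0 \<le> g n U" using t \<beta> by (simp add: g_U)
      ultimately show ?thesis using w kn by (simp add: add_pos_nonneg)
    qed
    then show ?thesis unfolding u(3) g_convex_combination using gZ u
      by (cases "u = 0") (auto intro!: add_nonneg_pos)
  next
    case False
    then have p: "0 < p" by simp
    show ?thesis
    proof (cases "Z $ 1 = 0")
      case True
      have "x $ 1 = u * p" using u True by (simp add: p_def del: affine_piece_nth)
      then have "u = 0" using x(2) u p by (simp add: mult_le_0_iff)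
      then show ?thesis using u gZ by simp
    next
      case False
      then have Z1: "Z $ 1 < 0" using P_r_1 by simp
      have x1: "x $ 1 = (1 - u) * Z $ 1 + u * p" unfolding u p_def by simp
      have x2: "x $ 2 = (1 - u) * Z $ 2" unfolding u using fL_Y_nth(2) by (simp del: affine_piece_nth)
      \<comment> \<open>This \<open>w\<close> puts the point \<open>y\<close> of the segment from
        \<open>Z\<close> to \<open>Y\<close> on the vertical line through \<open>x\<close>.\<close>
      define w where "w = 1 - x $ 1 / Z $ 1"
      have wZ: "(1 - w) * Z $ 1 = x $ 1" using Z1 by (simp add: w_def)
      have w1: "w \<le> 1" using x(2) Z1 by (simp add: w_def divide_nonpos_neg)
      have "w * (- Z $ 1) = u * (p - Z $ 1)" using wZ x1 by (simp add: algebra_simps)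
      moreover have "0 \<le> u * (p - Z $ 1)" using u p Z1 by simp
      ultimately have w0: "0 \<le> w" using Z1 by (metis neg_0_less_iff_less zero_le_mult_iff not_le)
      define y where "y = (1 - w) *\<^sub>R Z + w *\<^sub>R Y"
      have y1: "y $ 1 = x $ 1" using wZ Y_1 by (simp add: y_def)
      have "(- Z $ 1) * (x $ 2 - y $ 2) = u * (p * Z $ 2 + (Z $ 1 - p) * Y $ 2)"
        using wZ x1 x2 unfolding y_def by (simp, algebra)
      also have "\<dots> \<ge> 0" using fL_Y_above u by (simp only: p_def mult_nonneg_nonneg)
      finally have "(- Z $ 1) * (x $ 2 - y $ 2) \<ge> 0" .
      then have "y $ 2 \<le> x $ 2" using Z1 by (simp only: zero_le_mult_iff) linarith
      moreover have "g k x = g k y + e k * (x $ 2 - y $ 2)" by (simp add: g_eq y1 algebra_simps)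
      moreover have "0 < g k y" unfolding y_def g_convex_combination using gZ gkY w0 w1
        by (cases "w = 0") (auto intro!: add_nonneg_pos)
      moreover have "0 \<le> e k * (x $ 2 - y $ 2)" using \<open>y $ 2 \<le> x $ 2\<close> ek by simp
      ultimately show ?thesis by linarith
    qed
  qed
qed

text \<open>Otherwise \<open>f x\<close> can be scaled away from the origin within the region
  \<open>g k \<le> 0\<close> of the lower left quadrant. The image of \<open>C\<close> does not meet
  that region, so \<open>f x\<close> is outside this image, and the inverse of \<open>f\<close>
  takes \<open>x\<close> outside \<open>C\<close>.\<close>

lemma g_image_right:
  assumes x: "x \<in> C \<union> inside C" "0 < x $ 1" "f x $ 1 \<le> 0"
    and k: "k \<le> n" and gY: "1 \<le> i" "i \<le> k" "0 < g i Y" and gZ: "1 \<le> j" "j \<le> k" "0 < g j Z"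
  shows "0 < g k (f x)"
proof (rule ccontr)
  assume neg: "\<not> 0 < g k (f x)"
  have k1: "1 \<le> k" using gY by simp
  have gkY: "0 < g k Y" using g_Sigma_mono[of i k Y] k gY Y_1 by simp
  have gkZ: "0 < g k Z" using g_Z_mono[of j k] k gZ by simp
  have gYZ: "0 < g k z" if "z \<in> closed_segment Y Z" for z
  proof -
    from that obtain w where "0 \<le> w" "w \<le> 1" "z = (1 - w) *\<^sub>R Y + w *\<^sub>R Z"
      by (rule closed_segmentE)
    then show ?thesis using gkY gkZ
      by (cases "w = 0") (auto simp: g_convex_combination intro!: add_nonneg_pos)
  qed
  have y2: "f x $ 2 < 0" using x(2) \<delta>\<^sub>R f_right[of x] by simp
  \<comment> \<open>Such a point would come from the right part of \<open>C\<close>. Its image on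
    the left lies on the segment from \<open>Y\<close> to \<open>Z\<close> or on the one from
    \<open>Z\<close> to \<open>fL Y\<close>, and \<open>g k\<close> is positive there.\<close>
  have fC: "y \<notin> f ` C" if y: "y $ 1 \<le> 0" "y $ 2 < 0" "g k y \<le> 0" for y
  proof
    assume "y \<in> f ` C"
    then obtain z where z: "z \<in> C" "y = f z" by auto
    have z1: "0 < z $ 1"
    proof (rule ccontr)
      assume "\<not> 0 < z $ 1"
      then have "y $ 2 = - \<delta>\<^sub>L * z $ 1" "z $ 1 \<le> 0" using z f_left[of z] by auto
      then show False using y \<delta>\<^sub>L by (simp add: mult_less_0_iff zero_less_mult_iff)
    qed
    have "\<exists>m. 0 \<le> m \<and> m < int r \<and> z \<in> closed_segment (P m) (P (m + 1))"
      using z(1)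
    proof (cases rule: C_cases)
      case (2 m)
      then have "m = 0" using edge_left_1[of z m] z1 by force
      then show ?thesis using 2 r by (intro exI[of _ 0]) auto
    next
      case (3 m)
      then show ?thesis by (intro exI[of _ m]) auto
    qed (use segment_U(1) segment_Z_U(1) z1 in force)+
    then obtain m where m: "0 \<le> m" "m < int r" "z \<in> closed_segment (P m) (P (m + 1))" by blast
    show False
    proof (cases "m = int r - 1")
      case True
      then have "z \<in> closed_segment (P (int r - 1)) Y" using last_edge_cases(2)[of z] m z1 by simp
      then have "y \<in> closed_segment Z (fL Y)"
        using affine_piece_closed_segment[of \<tau>\<^sub>R \<delta>\<^sub>R "P (int r - 1)" Y] fR_P_last fY f_right[of z] z z1
        by auto
      then show False using g_image_last_edge[OF k1 k gY gkZ] y by force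
    next
      case False
      then have ye: "y \<in> closed_segment (P (m + 1)) (P (m + 1 + 1))"
        using edge_right_image[of m] m f_right[of z] z z1 by (auto simp: algebra_simps)
      show False
      proof (cases "m + 1 = int r - 1")
        case True
        moreover from True have "m + 1 + 1 = int r" by simp
        ultimately have "y \<in> closed_segment (P (int r - 1)) Z" using ye by metis
        then show False using last_edge_cases(1) y gYZ by force
      next
        case m': False
        then have "0 < P (m + 1) $ 1" "0 < P (m + 1 + 1) $ 1" using m False P_right by auto
        moreover obtain w where "0 \<le> w" "w \<le> 1" "y = (1 - w) *\<^sub>R P (m + 1) + w *\<^sub>R P (m + 1 + 1)"
          using ye by (rule closed_segmentE)
        ultimately have "0 < y $ 1" by (cases "w = 0") (auto intro!: add_nonneg_pos)
        then show False using y by simp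
      qed
    qed
  qed
  have fC_compact: "compact (f ` C)"
    using compact_C by (intro compact_continuous_image continuous_on_bcnf)
  have "f x \<in> outside (f ` C)"
  proof (rule ray_avoids_imp_outside)
    show "bounded (f ` C)" using fC_compact by (rule compact_imp_bounded)
    show "f x \<noteq> 0" using y2 by auto
    fix u :: real assume u: "0 \<le> u"
    show "f x + u *\<^sub>R f x \<notin> f ` C"
    proof (rule fC)
      have *: "(f x + u *\<^sub>R f x) $ i = (1 + u) * f x $ i" for i by (simp add: algebra_simps)
      show "(f x + u *\<^sub>R f x) $ 1 \<le> 0" unfolding * using u x(3) by (simp add: mult_nonneg_nonpos)
      show "(f x + u *\<^sub>R f x) $ 2 < 0" unfolding * using u y2 by (simp add: mult_pos_neg)
      \<comment> \<open>The constant term \<open>c k\<close> of the affine function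
        \<open>g k\<close> is positive, so scaling up a nonpositive value leaves it
        nonpositive.\<close>
      have "g k (f x + u *\<^sub>R f x) = (1 + u) * g k (f x) - u * c k"
        by (simp add: g_eq algebra_simps)
      also have "\<dots> \<le> 0"
        using neg u lucas_sum_pos[of k] k k1 by (smt (verit) mult_nonneg_nonneg mult_nonneg_nonpos)
      finally show "g k (f x + u *\<^sub>R f x) \<le> 0" .
    qed
  qed
  moreover have "bcnf_inv \<tau>\<^sub>L \<delta>\<^sub>L \<tau>\<^sub>R \<delta>\<^sub>R ` outside (f ` C)
      \<subseteq> outside (bcnf_inv \<tau>\<^sub>L \<delta>\<^sub>L \<tau>\<^sub>R \<delta>\<^sub>R ` f ` C)"
    using fC_compact \<delta>\<^sub>L \<delta>\<^sub>R by (intro homeomorphism_image_outside[where h' = f])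
      (auto simp: continuous_on_bcnf continuous_on_bcnf_inv bcnf_inv_bcnf bcnf_bcnf_inv)
  ultimately have "bcnf_inv \<tau>\<^sub>L \<delta>\<^sub>L \<tau>\<^sub>R \<delta>\<^sub>R (f x)
      \<in> outside (bcnf_inv \<tau>\<^sub>L \<delta>\<^sub>L \<tau>\<^sub>R \<delta>\<^sub>R ` f ` C)" by blast
  then have "x \<in> outside C" using \<delta>\<^sub>L \<delta>\<^sub>R by (simp add: image_image bcnf_inv_bcnf)
  then show False using x union_with_inside by blast
qed

end

subsection \<open>Words and return times\<close>

text \<open>The infimum of a nonempty set of extended naturals is attained, while the empty set
  gives infinity, which exceeds \<open>enat k\<close>.\<close>

lemma chi_L_le_iff: "chi_L h x \<le> enat k \<longleftrightarrow> (\<exists>j. 1 \<le> j \<and> j \<le> k \<and> 0 < (h ^^ j) x $ 1)"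
proof
  let ?A = "enat ` {p. 1 \<le> p \<and> (h ^^ p) x \<notin> Pi_L}"
  assume le: "chi_L h x \<le> enat k"
  have "?A \<noteq> {}"
  proof
    assume "?A = {}"
    then have "chi_L h x = Inf {}" unfolding chi_L_def by (simp only:)
    then show False using le by (simp add: Inf_enat_def)
  qed
  then obtain a where "a \<in> ?A" by blast
  then have "chi_L h x \<in> ?A" unfolding chi_L_def by (rule wellorder_InfI)
  then show "\<exists>j. 1 \<le> j \<and> j \<le> k \<and> 0 < (h ^^ j) x $ 1"
    using le by (auto simp: Pi_L_def not_le)
next
  assume "\<exists>j. 1 \<le> j \<and> j \<le> k \<and> 0 < (h ^^ j) x $ 1"
  then obtain j where j: "1 \<le> j" "j \<le> k" "0 < (h ^^ j) x $ 1" by blast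
  then have "chi_L h x \<le> enat j"
    unfolding chi_L_def by (intro Inf_lower imageI) (auto simp: Pi_L_def)
  also have "\<dots> \<le> enat k" using j by simp
  finally show "chi_L h x \<le> enat k" .
qed

text \<open>The leading block of \<open>L\<close>s is kept apart because only the letter to its left
  decides which word it belongs to.\<close>

lemma word_decomposition:
  "\<exists>a ws. w = replicate a L @ concat ws \<and> a \<le> length w
     \<and> set ws \<subseteq> {R # replicate p L | p. p \<le> length w}"
proof (induction w)
  case Nil
  then show ?case by (intro exI[of _ 0] exI[of _ "[]"]) simp
next
  case (Cons x w)
  then obtain a ws where w: "w = replicate a L @ concat ws" "a \<le> length w"
    "set ws \<subseteq> {R # replicate p L | p. p \<le> length w}" by blast
  show ?case
  proof (cases x)
    case L
    then show ?thesis using w(2,3)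
      by (intro exI[of _ "Suc a"] exI[of _ ws]) (subst w(1), force)
  next
    case R
    have "R # replicate a L \<in> {R # replicate p L | p. p \<le> length (x # w)}" using w(2) by auto
    then show ?thesis using R w(2,3)
      by (intro exI[of _ 0] exI[of _ "(R # replicate a L) # ws"]) (subst (1) w(1), force)
  qed
qed

text \<open>This crude bound by the length suffices: the words that arise start with
  \<open>R\<close> and have length at most one more than the largest admissible exponent, whichever
  symbols are chosen on the switching line.\<close>

lemma R_word_decomposition:
  "\<exists>ws. R # w = concat ws \<and> set ws \<subseteq> {R # replicate p L | p. p \<le> length w}"
proof -
  obtain a ws where w: "w = replicate a L @ concat ws" "a \<le> length w"
    "set ws \<subseteq> {R # replicate p L | p. p \<le> length w}" using word_decomposition by blast
  have "R # w = concat ((R # replicate a L) # ws)" by (subst w(1)) simp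
  moreover have "set ((R # replicate a L) # ws) \<subseteq> {R # replicate p L | p. p \<le> length w}"
    using w(2,3) by auto
  ultimately show ?thesis by blast
qed

section \<open>The polygonal chain as a union of edges\<close>

lemma polygonal_chain_append:
  "polygonal_chain (xs @ x # y # ys) = polygonal_chain (xs @ [x]) \<union> polygonal_chain (x # y # ys)"
proof (induction xs)
  case Nil
  then show ?case by auto
next
  case (Cons z xs)
  then show ?case by (cases xs) auto
qed

lemma polygonal_chain_map_upto:
  fixes p :: "int \<Rightarrow> real^2"
  assumes "i < j"
  shows "polygonal_chain (map p [i..j]) = (\<Union>k\<in>{i..<j}. closed_segment (p k) (p (k + 1)))"
proof -
  have "i + 1 \<le> j" using assms by simp
  then show ?thesis
  proof (induction j rule: int_ge_induct)
    case base
    have "[i..i + 1] = [i, i + 1]" by (simp add: upto.simps)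
    moreover have "{i..<i + 1} = {i}" by auto
    ultimately show ?case by (simp add: insert_absorb)
  next
    case (step j)
    have "[i..j + 1] = [i..j - 1] @ [j, j + 1]"
      using step.hyps upto_rec2[of i "j + 1"] upto_rec2[of i j] by simp
    moreover have "[i..j] = [i..j - 1] @ [j]" using step.hyps upto_rec2[of i j] by simp
    moreover have "{i..<j + 1} = insert j {i..<j}" using step.hyps by auto
    ultimately show ?case
      using step.IH polygonal_chain_append[of "map p [i..j - 1]" "p j" "p (j + 1)" "[]"] by auto
  qed
qed

section \<open>Return to the right half-plane and the covering\<close>

context bcnf_polygon
begin

lemma polygonal_chain_eq_C:
  "polygonal_chain ([U] @ map P [- (int n - 1)..int r - 1] @ [Z, U]) = C"
proof -
  let ?i = "1 - int n"
  have "[?i..int r] = [?i..int r - 1] @ [int r]" using n r upto_rec2[of ?i "int r"] by simp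
  moreover have "[?i..int r] = ?i # [?i + 1..int r]" using n r upto_rec1[of ?i "int r"] by simp
  ultimately have l: "[U] @ map P [- (int n - 1)..int r - 1] @ [Z, U] = U # P ?i # map P [?i + 1..int r] @ [U]"
    and l': "P ?i # map P [?i + 1..int r] = map P [?i..int r - 1] @ [Z]"
    by (auto simp flip: list.map(2)) (simp add: algebra_simps)+
  have "polygonal_chain (P ?i # map P [?i + 1..int r] @ [U])
      = polygonal_chain (map P [?i..int r - 1] @ Z # U # [])"
    using l' by (metis append.assoc append_Cons append_Nil)
  also have "\<dots> = polygonal_chain (map P [?i..int r]) \<union> closed_segment Z U"
    unfolding polygonal_chain_append using \<open>[?i..int r] = [?i..int r - 1] @ [int r]\<close> by auto
  also have "polygonal_chain (map P [?i..int r]) = (\<Union>k\<in>{?i..<int r}. closed_segment (P k) (P (k + 1)))"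
    using n r by (intro polygonal_chain_map_upto) simp
  finally show ?thesis unfolding l C_def by auto
qed

lemma f_funpow_left:
  assumes "\<And>i. i < m \<Longrightarrow> g i x \<le> 0" "i \<le> m"
  shows "(f ^^ i) x = (fL ^^ i) x"
  using assms(2)
proof (induction i)
  case (Suc i)
  then show ?case using assms(1)[of i] f_left by (simp add: g_def)
qed simp

lemma f_funpow_invariant: "x \<in> C \<union> inside C \<Longrightarrow> (f ^^ m) x \<in> C \<union> inside C"
proof (induction m)
  case (Suc m)
  then show ?case using f_invariant by simp
qed simp

text \<open>The orbits under \<open>f\<close> and \<open>fL\<close> agree up to the first exit, so
  the least \<open>m\<close> with \<open>g m x > 0\<close> is a visit of the \<open>f\<close>-orbit
  to the right half-plane.\<close>

lemma first_leaving_time: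
  assumes "x $ 1 \<le> 0" "1 \<le> k" "0 < g k x"
  shows "\<exists>m. 1 \<le> m \<and> m \<le> k \<and> 0 < (f ^^ m) x $ 1"
proof -
  define m where "m = (LEAST m. 0 < g m x)"
  have m: "0 < g m x" "m \<le> k" unfolding m_def using assms(3) by (auto intro: LeastI Least_le)
  have "g i x \<le> 0" if "i < m" for i
    using not_less_Least[of i "\<lambda>m. 0 < g m x"] that by (simp add: m_def)
  then have "(f ^^ m) x = (fL ^^ m) x" by (rule f_funpow_left) auto
  moreover have "m \<noteq> 0" using m assms(1) by (intro notI) simp
  ultimately show ?thesis using m by (intro exI[of _ m]) (auto simp: g_def)
qed

text \<open>If the maximum is at least \<open>Suc n\<close>, the general bound
  \<open>leaves_left\<close> is enough. Otherwise both times are finite and the maximum is at most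
  \<open>n\<close>, which is the range of \<open>g_image_right\<close>.\<close>

lemma return_to_right:
  assumes x: "x \<in> C \<union> inside C" "0 < x $ 1"
  shows "\<exists>m. enat m \<le> max (chi_L fL Y) (chi_L fL Z) \<and> 0 < (f ^^ Suc m) x $ 1"
proof (cases "f x $ 1 \<le> 0")
  case False
  then show ?thesis by (intro exI[of _ 0]) (simp add: zero_enat_def[symmetric])
next
  case True
  let ?p = "max (chi_L fL Y) (chi_L fL Z)"
  have "\<exists>k. 1 \<le> k \<and> enat k \<le> ?p \<and> 0 < g k (f x)"
  proof (cases "enat (Suc n) \<le> ?p")
    case True
    obtain k where "1 \<le> k" "k \<le> Suc n" "0 < g k (f x)"
      using leaves_left[OF f_invariant[OF x(1)] \<open>f x $ 1 \<le> 0\<close>] by blast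
    moreover have "enat k \<le> ?p" using \<open>k \<le> Suc n\<close> True order_trans[of "enat k" "enat (Suc n)"] by simp
    ultimately show ?thesis by blast
  next
    case False
    then have "?p < enat (Suc n)" by (simp only: not_le)
    then obtain k where k: "?p = enat k" "k \<le> n" by (metis enat_ord_simps(2) less_Suc_eq_le less_enatE)
    then have "chi_L fL Y \<le> enat k" "chi_L fL Z \<le> enat k" by (metis max.cobounded1 max.cobounded2)+
    then obtain i j where "1 \<le> i" "i \<le> k" "0 < g i Y" "1 \<le> j" "j \<le> k" "0 < g j Z"
      unfolding chi_L_le_iff g_def by blast
    then have "0 < g k (f x)" "1 \<le> k" using g_image_right[OF x True k(2)] by auto
    then show ?thesis using k by (intro exI[of _ k]) simp
  qed
  then obtain k where k: "1 \<le> k" "enat k \<le> ?p" "0 < g k (f x)" by blast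
  then obtain m where "m \<le> k" "0 < (f ^^ m) (f x) $ 1" using first_leaving_time[OF True] by blast
  moreover have "enat m \<le> ?p" using k(2) \<open>m \<le> k\<close> order_trans[of "enat m" "enat k"] by simp
  ultimately show ?thesis by (intro exI[of _ m]) (simp add: funpow_swap1)
qed

lemma recurrent_right:
  "recurrent f {R # replicate p L | p. enat p \<le> max (chi_L fL Y) (chi_L fL Z)}
     {x \<in> C \<union> inside C. 0 < x $ 1}" (is "recurrent f ?W ?S")
  unfolding recurrent_def
proof
  fix x assume x: "x \<in> ?S"
  then obtain m where m: "enat m \<le> max (chi_L fL Y) (chi_L fL Z)" "0 < (f ^^ Suc m) x $ 1"
    using return_to_right by blast
  have "\<exists>ws. set ws \<subseteq> ?W \<and> w = concat ws" if w: "w \<in> Gamma_words f x (Suc m)" for w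
  proof -
    have len: "length w = Suc m" and "w ! 0 \<in> gamma_set x"
      using w by (force simp: Gamma_words_def)+
    then have "w ! 0 = R" using x by (auto simp: gamma_set_def)
    then obtain w' where w': "w = R # w'" "length w' = m" using len by (cases w) auto
    obtain ws where ws: "w = concat ws" "set ws \<subseteq> {R # replicate p L | p. p \<le> m}"
      using R_word_decomposition[of w'] w' by auto
    have "{R # replicate p L | p. p \<le> m} \<subseteq> ?W"
      using m(1) order_trans[of "enat _" "enat m"] by (auto intro: order_trans simp del: max.bounded_iff)
    then show ?thesis using ws by blast
  qed
  then show "\<exists>n\<ge>1. (f ^^ n) x \<in> ?S \<and> (\<forall>w\<in>Gamma_words f x n. \<exists>ws. set ws \<subseteq> ?W \<and> w = concat ws)"
    using x m(2) f_funpow_invariant[of x "Suc m"] by (intro exI[of _ "Suc m"]) auto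
qed

lemma C_filled_covered:
  "C \<union> inside C \<subseteq> (\<Union>i\<in>{- int (Suc n)..0}. int_iter f i ` {x \<in> C \<union> inside C. 0 < x $ 1})"
proof
  fix x assume x: "x \<in> C \<union> inside C"
  have "\<exists>m \<le> Suc n. 0 < (f ^^ m) x $ 1"
  proof (cases "x $ 1 \<le> 0")
    case True
    then obtain k where k: "1 \<le> k" "k \<le> Suc n" "0 < g k x" using leaves_left[OF x] by blast
    then obtain m where "m \<le> k" "0 < (f ^^ m) x $ 1" using first_leaving_time[OF True] by blast
    then show ?thesis using k(2) by (intro exI[of _ m]) simp
  next
    case False
    then show ?thesis by (intro exI[of _ 0]) simp
  qed
  then obtain m where m: "m \<le> Suc n" "0 < (f ^^ m) x $ 1" by blast
  have "x = int_iter f (- int m) ((f ^^ m) x)"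
    using int_iter_minus_funpow[OF bij_bcnf[OF \<delta>\<^sub>L \<delta>\<^sub>R]] by simp
  then show "x \<in> (\<Union>i\<in>{- int (Suc n)..0}. int_iter f i ` {x \<in> C \<union> inside C. 0 < x $ 1})"
    using m f_funpow_invariant[OF x, of m] by (intro UN_I[of "- int m"]) auto
qed

end

section \<open>Translation of the geometric hypotheses into the orbit locales\<close>

theorem proposition6p6:
  fixes \<tau>\<^sub>L \<tau>\<^sub>R \<delta>\<^sub>L \<delta>\<^sub>R \<beta> :: real
    and f :: "real^2 \<Rightarrow> real^2"
    and X Y Z U V :: "real^2"
    and r l :: nat
    and \<Omega> \<Omega>\<^sub>r\<^sub>e\<^sub>c :: "(real^2) set"
    and p\<^sub>m\<^sub>a\<^sub>x :: enat
    and W :: "symb list set"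
  assumes "\<delta>\<^sub>L > 0" and "\<delta>\<^sub>R > 0"
    and f: "f = bcnf \<tau>\<^sub>L \<delta>\<^sub>L \<tau>\<^sub>R \<delta>\<^sub>R"
    and "\<beta> > 0" and X: "X = vector [0, \<beta>]"
    and "\<exists>i::nat. i \<ge> 1 \<and> int_iter f (int i) X $ 1 \<le> 0"
    and "\<exists>j::nat. j \<ge> 1 \<and> int_iter f (- int j) X $ 1 \<ge> 0"
    and r: "r = (LEAST i. i \<ge> 1 \<and> int_iter f (int i) X $ 1 \<le> 0)"
    and l: "l = (LEAST j. j \<ge> 1 \<and> int_iter f (- int j) X $ 1 \<ge> 0)"
    and Z: "Z = int_iter f (int r) X"
    and Y: "line_through Z (inv f Z) \<inter> Sigma_line = {Y}"
    and V: "V = int_iter f (- (int l - 1)) X"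
    and U: "line_through V (f V) \<inter> f ` Sigma_line = {U}"
    and \<Omega>: "\<Omega> = (let C = polygonal_chain
                  ([U] @ map (\<lambda>k. int_iter f k X) [- (int l - 2)..int r - 1] @ [Z, U])
                in C \<union> inside C)"
    and "Y $ 2 > inv f U $ 2"
    and "above_line Z (line_through (inv f U) V)"
    and "right_of_line Z (line_through V (f V))"
    and \<Omega>\<^sub>r\<^sub>e\<^sub>c: "\<Omega>\<^sub>r\<^sub>e\<^sub>c = {x \<in> \<Omega>. x $ 1 > 0}"
    and p\<^sub>m\<^sub>a\<^sub>x: "p\<^sub>m\<^sub>a\<^sub>x = max (chi_L (affine_piece \<tau>\<^sub>L \<delta>\<^sub>L) Y) (chi_L (affine_piece \<tau>\<^sub>L \<delta>\<^sub>L) Z)"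
    and W: "W = {R # replicate p L | p. enat p \<le> p\<^sub>m\<^sub>a\<^sub>x}"
  shows "recurrent f W \<Omega>\<^sub>r\<^sub>e\<^sub>c \<and> \<Omega> \<subseteq> (\<Union>i\<in>{- int l..0}. int_iter f i ` \<Omega>\<^sub>r\<^sub>e\<^sub>c)"
proof -
  define P where "P k = int_iter f k X" for k
  have bij: "bij f" using f assms(1,2) bij_bcnf by blast
  have fP: "f (P k) = P (k + 1)" for k unfolding P_def by (rule int_iter_Suc[OF bij])
  have P0: "P 0 = vector [0, \<beta>]" by (simp add: P_def int_iter_def X)
  have f1: "f x $ 1 = (if x $ 1 \<le> 0 then \<tau>\<^sub>L else \<tau>\<^sub>R) * x $ 1 + x $ 2 + 1" for x
    by (simp add: f bcnf_def)
  have f2: "f x $ 2 = - (if x $ 1 \<le> 0 then \<delta>\<^sub>L else \<delta>\<^sub>R) * x $ 1" for x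
    by (simp add: f bcnf_def)
  have rr: "1 \<le> r \<and> P (int r) $ 1 \<le> 0" unfolding r P_def by (rule LeastI_ex) fact
  have ll: "1 \<le> l \<and> P (- int l) $ 1 \<ge> 0" unfolding l P_def by (rule LeastI_ex) fact
  have r_min: "0 < P (int i) $ 1" if "1 \<le> i" "i < r" for i
    using not_less_Least[of i "\<lambda>i. i \<ge> 1 \<and> int_iter f (int i) X $ 1 \<le> 0"] that
    unfolding r P_def by auto
  have l_min: "P (- int j) $ 1 < 0" if "1 \<le> j" "j < l" for j
    using not_less_Least[of j "\<lambda>j. j \<ge> 1 \<and> int_iter f (- int j) X $ 1 \<ge> 0"] that
    unfolding l P_def by auto
  have "P 1 $ 1 = \<beta> + 1" using fP[of 0] f1[of "P 0"] P0 by simp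
  then have "r \<noteq> 1" using rr \<open>\<beta> > 0\<close> by auto
  then have r2: "2 \<le> r" using rr by simp
  \<comment> \<open>A point with nonnegative first coordinate is not mapped above the horizontal
    axis, but \<open>X\<close> is above it.\<close>
  have "P (- 1) $ 1 < 0"
  proof (rule ccontr)
    assume "\<not> P (- 1) $ 1 < 0"
    then have "f (P (- 1)) $ 2 \<le> 0" using assms(2) by (auto simp: f2)
    then show False using fP[of "- 1"] P0 \<open>\<beta> > 0\<close> by simp
  qed
  then have "l \<noteq> 1" using ll by auto
  then have l2: "2 \<le> l" using ll by simp
  define n where "n = l - 1"
  have n: "1 \<le> n" "int l = int n + 1" "l = Suc n" using l2 by (auto simp: n_def)
  have V': "V = P (- int n)" by (simp add: V P_def n)
  have Z': "Z = P (int r)" by (simp add: Z P_def)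
  \<comment> \<open>\<open>V\<close> is the image of \<open>P (- l)\<close>, which is not on the
    left.\<close>
  have V_2: "P (- int n) $ 2 \<le> 0"
    using fP[of "- int l"] f2[of "P (- int l)"] ll n assms(1,2) by (auto simp: mult_nonneg_nonneg)
  interpret orb: bcnf_orbit \<tau>\<^sub>L \<delta>\<^sub>L \<tau>\<^sub>R \<delta>\<^sub>R \<beta> n r P
  proof
    show "0 < P k $ 1" if "1 \<le> k" "k < int r" for k
      using r_min[of "nat k"] that by simp
    show "P k $ 1 < 0" if "- int n \<le> k" "k < 0" for k
      using l_min[of "nat (- k)"] that n by simp
  qed (use assms(1,2,4) n r2 P0 rr V_2 fP f in auto)
  have fV: "f V = P (1 - int n)" using fP[of "- int n"] V' by (simp add: algebra_simps)
  have "U \<in> line_through V (f V)" "U \<in> f ` Sigma_line" using U by auto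
  then obtain u t where ut: "U = u *\<^sub>R V + t *\<^sub>R f V" "u + t = 1" by (auto simp: affine_hull_2)
  have U2: "U $ 2 = 0" using \<open>U \<in> f ` Sigma_line\<close> by (auto simp: Sigma_line_def f2)
  have Ut: "U = (1 - t) *\<^sub>R P (- int n) + t *\<^sub>R P (1 - int n)"
  proof -
    have "u = 1 - t" using ut(2) by simp
    then show ?thesis using ut(1) by (simp add: fV) (simp add: V')
  qed
  have tD: "P (- int n) $ 2 + t * (P (1 - int n) - P (- int n)) $ 2 = 0"
    using U2 unfolding Ut by (simp add: algebra_simps)
  have t0: "0 \<le> t" using tD V_2 orb.D_2 by (smt (verit) mult_neg_pos)
  have t1: "t < 1"
  proof (rule ccontr)
    assume "\<not> t < 1"
    then have "1 * (P (1 - int n) - P (- int n)) $ 2 \<le> t * (P (1 - int n) - P (- int n)) $ 2"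
      using orb.D_2 by (intro mult_right_mono) auto
    then show False using tD orb.P_upper[of "1 - int n"] n by simp
  qed
  have "inv f Z = P (int r - 1)"
    using fP[of "int r - 1"] Z' bij by (simp add: bij_is_inj inv_f_eq)
  then have "Y \<in> line_through (P (int r)) (P (int r - 1))" and Y1: "Y $ 1 = 0"
    using Y Z' by (auto simp: Sigma_line_def)
  then obtain s u where su: "Y = s *\<^sub>R P (int r) + u *\<^sub>R P (int r - 1)" "s + u = 1"
    by (auto simp: affine_hull_2)
  have Ys: "Y = (1 - s) *\<^sub>R P (int r - 1) + s *\<^sub>R P (int r)"
  proof -
    have "u = 1 - s" using su(2) by simp
    then show ?thesis using su(1) by (simp add: add.commute)
  qed
  have Pr: "0 < P (int r - 1) $ 1" using orb.P_right[of "int r - 1"] r2 by simp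
  have s_eq: "s * (P (int r - 1) $ 1 - P (int r) $ 1) = P (int r - 1) $ 1"
    using Y1 unfolding Ys by (simp add: algebra_simps)
  have s0: "0 < s" using s_eq Pr rr by (smt (verit) mult_nonneg_nonneg zero_less_mult_iff)
  have s1: "s \<le> 1"
  proof (rule ccontr)
    assume "\<not> s \<le> 1"
    then have "1 * (P (int r - 1) $ 1 - P (int r) $ 1) < s * (P (int r - 1) $ 1 - P (int r) $ 1)"
      using Pr rr by (intro mult_strict_right_mono) auto
    then show False using s_eq rr by simp
  qed
  let ?F = "vector [0, U $ 1 - 1] :: real^2"
  have "f ?F = U" using U2 by (intro vec2_eqI) (auto simp: f1 f2)
  then have invU: "inv f U = ?F" using bij by (metis bij_is_inj inv_f_f)
  have side_hull: "orb.side q = 0" if "q \<in> line_through V (f V)" for q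
  proof -
    from that obtain u w where "q = u *\<^sub>R V + w *\<^sub>R f V" "u + w = 1"
      by (auto simp: affine_hull_2)
    moreover from this have "u = 1 - w" by simp
    ultimately have "q = (1 - w) *\<^sub>R V + w *\<^sub>R f V" by simp
    then show ?thesis unfolding V' fV[unfolded V'] by (simp add: orb.side_convex_combination)
  qed
  have side_Z: "0 < orb.side (P (int r))"
  proof -
    obtain q where q: "q \<in> line_through V (f V)" "q $ 2 = Z $ 2" "q $ 1 < Z $ 1"
      using assms(17) by (auto simp: right_of_line_def)
    have "orb.side Z - orb.side q = (Z $ 1 - q $ 1) * (P (1 - int n) - P (- int n)) $ 2"
      unfolding orb.side_def q(2) by (simp only: algebra_simps)
    then show ?thesis using side_hull[OF q(1)] q(3) orb.D_2 Z' by simp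
  qed
  \<comment> \<open>\<open>fL\<close> maps the line through \<open>inv f U\<close> and
    \<open>V\<close> to the line through \<open>V\<close> and \<open>f V\<close>. As
    \<open>D\<close> points up, being above the former becomes being to the right of the
    latter.\<close>
  have side_fL_Z: "0 < orb.side (affine_piece \<tau>\<^sub>L \<delta>\<^sub>L (P (int r)))"
  proof -
    obtain q where q: "q \<in> line_through ?F V" "q $ 1 = Z $ 1" "q $ 2 < Z $ 2"
      using assms(16) unfolding invU by (auto simp: above_line_def)
    obtain u w where "q = u *\<^sub>R ?F + w *\<^sub>R V" "u + w = 1"
      using q(1) by (auto simp: affine_hull_2)
    moreover from this have "u = 1 - w" by simp
    ultimately have "q = (1 - w) *\<^sub>R ?F + w *\<^sub>R V" by simp
    moreover have "affine_piece \<tau>\<^sub>L \<delta>\<^sub>L ?F = U" using U2 by (intro vec2_eqI) auto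
    moreover have "affine_piece \<tau>\<^sub>L \<delta>\<^sub>L V = f V" using V' fV orb.fL_V by simp
    moreover have "orb.side U = 0" "orb.side (f V) = 0"
      using side_hull \<open>U \<in> line_through V (f V)\<close> hull_inc[of "f V" "{V, f V}"] by auto
    ultimately have q0: "orb.side (affine_piece \<tau>\<^sub>L \<delta>\<^sub>L q) = 0"
      by (simp add: affine_piece_convex_combination orb.side_convex_combination)
    have "orb.side (affine_piece \<tau>\<^sub>L \<delta>\<^sub>L Z) - orb.side (affine_piece \<tau>\<^sub>L \<delta>\<^sub>L q)
        = (Z $ 2 - q $ 2) * (P (1 - int n) - P (- int n)) $ 2"
      unfolding orb.side_def affine_piece_nth q(2) by (simp only: algebra_simps)
    then show ?thesis using q0 q(3) orb.D_2 Z' by simp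
  qed
  interpret bcnf_polygon \<tau>\<^sub>L \<delta>\<^sub>L \<tau>\<^sub>R \<delta>\<^sub>R \<beta> n r P t s U Y
    by unfold_locales
      (use Ut t0 t1 U2 Ys s0 s1 Y1 side_Z side_fL_Z assms(15) invU in auto)
  have \<Omega>_eq: "\<Omega> = C \<union> inside C"
  proof -
    have "[U] @ map (\<lambda>k. int_iter f k X) [- (int l - 2)..int r - 1] @ [Z, U]
        = [U] @ map P [- (int n - 1)..int r - 1] @ [P (int r), U]"
      using n Z' by (simp add: P_def[abs_def])
    then show ?thesis unfolding \<Omega> Let_def using polygonal_chain_eq_C by simp
  qed
  show ?thesis
    using recurrent_right C_filled_covered
    unfolding W p\<^sub>m\<^sub>a\<^sub>x \<Omega>\<^sub>r\<^sub>e\<^sub>c \<Omega>_eq n(3) Z' f by blast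
qed

end
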